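(* Let $\sigma_1=\sigma(s_1)$ and $\sigma_2=\sigma(s_2)$ be two elements of $\mathfrak D_{2g}\cap S(g)^{open}$. Then $\sigma_1$ and $\sigma_2$ are D-equivalent if and only if either $g$ is odd, or $g$ is even and the ratio $\det T(\tilde\sigma_1)/\det T(\tilde\sigma_2)$ is a square in $\mathbb F_p^*$.
   Context: Let $p$ be an odd prime and $K=\mathbb Q(\sqrt{-\Delta})$ ($\Delta>0$ a squarefree integer) an imaginary quadratic field in which $p$ is inert. Put $\mathbb Z_{p^2}=\mathbb Z_p[\sqrt{-\Delta}]$, $\mathbb F_{p^2}=\mathbb F_p[\sqrt{-\Delta}]$; bar denotes the nontrivial automorphism over $\mathbb Z_p$, resp. $\mathbb F_p$, and tilde denotes reduction modulo $p$. Let $g=\mathfrak r+\mathfrak s$ and $E=E_{\mathfrak r\mathfrak s}=\mathrm{diag}(1,\dots,1,-1,\dots,-1)$ ($\mathfrak r$ ones, $\mathfrak s$ minus ones). Let $G_V(\mathbb Z_p)$ be the group of matrices $\mathfrak g=h+k\sqrt{-\Delta}$, $h,k\in M_g(\mathbb Z_p)$, with $\mathfrak gE\bar{\mathfrak g}^t=\lambda E$ for some $\lambda\in\mathbb Z_p^*$, and let $\alpha:G_V(\mathbb Z_p)\to GSp_{2g}(\mathbb Z_p)$, $\alpha(\mathfrak g)=\begin{pmatrix} h& kE\\ -\Delta Ek& EhE\end{pmatrix}$. $S(g)^{open}$ is the set of matrices $\sigma=\sigma(s)=\begin{pmatrix}1_g& s\\0&p1_g\end{pmatrix}$ where $s\in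 M_g(\mathbb Z)$ is symmetric with entries in a fixed system of residues modulo $p$ (these are representatives of part of the cosets $\Gamma\backslash\Gamma\tau_p\Gamma$, $\tau_p=\mathrm{diag}(1_g,p1_g)$, $\Gamma=GSp_{2g}(\mathbb Z_p)$). For such $\sigma$ put $T(\sigma)=E+\Delta sEs$, and $T(\tilde\sigma)\in M_g(\mathbb F_p)$ is its reduction modulo $p$. Let $\mathbb F_{p^2}$ act on row vectors $(x,y)\in\mathbb F_p^g\times\mathbb F_p^g$ by $\sqrt{-\Delta}\cdot(x,y)=(-\Delta yE,xE)$, and let $W_\sigma\subset\mathbb F_p^{2g}$ be the row space of $(1_g,\tilde s)$. For even $j$ with $g\le j\le 2g$, $\mathfrak D_j$ is the set of $\sigma$ with $\dim_{\mathbb F_p}(\mathbb F_{p^2}W_\sigma)=j$. Two elements $\sigma_1,\sigma_2$ are D-equivalent if there exists $\mathfrak g\in G_V(\mathbb Z_p)$ such that $\sigma_1\alpha(\mathfrak g)\sigma_2^{-1}\in GSp_{2g}(\mathbb Z_p)$. *)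

theory Defs
  imports
    Complex_Main
    "HOL-Computational_Algebra.Computational_Algebra"
    "HOL-Algebra.Ideal"
    "Berlekamp_Zassenhaus.Finite_Field"
    "Jordan_Normal_Form.Matrix"
    "Jordan_Normal_Form.Determinant"
    "Jordan_Normal_Form.VS_Connect"
    "Jordan_Normal_Form.Gauss_Jordan_Elimination"
begin

text \<open>
  The prime is \<open>p = CARD('p)\<close> for a type \<open>'p\<close> of class \<open>prime_card\<close>, and the field with \<open>p\<close>
  elements is \<open>'p mod_ring\<close>.
\<close>

text \<open>
  \<open>\<int>\<^sub>p\<close> is the inverse limit of the rings of integers modulo \<open>p ^ n\<close>, the \<open>n\<close>-th component of an element
  being given by its representative in \<open>{0..<p ^ n}\<close>.
\<close>

typedef (overloaded) ('p::prime_card) padic_int =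
  "{x :: nat \<Rightarrow> int. \<forall>n. x n \<in> {0..<int CARD('p) ^ n} \<and> x (Suc n) mod int CARD('p) ^ n = x n}"
  by (rule exI[of _ "\<lambda>_. 0"]) simp

setup_lifting type_definition_padic_int

lemma padic_compatible:
  assumes "m \<le> n"
    and "\<forall>n. x n \<in> {0..<int CARD('p::prime_card) ^ n} \<and> x (Suc n) mod int CARD('p) ^ n = x n"
  shows "x n mod int CARD('p) ^ m = x m"
  using assms(1)
proof (induction n rule: dec_induct)
  case base
  then show ?case using assms(2) by (meson atLeastLessThan_iff mod_pos_pos_trivial)
next
  case (step n)
  have "x (Suc n) mod int CARD('p) ^ m = x (Suc n) mod int CARD('p) ^ n mod int CARD('p) ^ m"
    using step.hyps by (simp add: mod_mod_cancel le_imp_power_dvd)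
  then show ?case using assms(2) step.IH by simp
qed

lemma padic_mod_closed:
  fixes z :: "nat \<Rightarrow> int"
  assumes "z (Suc n) mod int CARD('p::prime_card) ^ n = z n mod int CARD('p) ^ n"
  shows "z n mod int CARD('p) ^ n \<in> {0..<int CARD('p) ^ n} \<and>
    z (Suc n) mod int CARD('p) ^ Suc n mod int CARD('p) ^ n = z n mod int CARD('p) ^ n"
proof -
  have "z (Suc n) mod int CARD('p) ^ Suc n mod int CARD('p) ^ n = z (Suc n) mod int CARD('p) ^ n"
    by (rule mod_mod_cancel) simp
  then show ?thesis
    using assms by simp
qed

instantiation padic_int :: (prime_card) comm_ring_1
begin

lift_definition zero_padic_int :: "'a padic_int" is "\<lambda>_. 0" by simp

lift_definition one_padic_int :: "'a padic_int" is "\<lambda>n. 1 mod int CARD('a) ^ n"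
  by (rule padic_mod_closed[of "\<lambda>_. 1"]) simp

lift_definition plus_padic_int :: "'a padic_int \<Rightarrow> 'a padic_int \<Rightarrow> 'a padic_int"
  is "\<lambda>x y n. (x n + y n) mod int CARD('a) ^ n"
  subgoal for x y n by (rule padic_mod_closed[of "\<lambda>n. x n + y n"]) (metis mod_add_eq)
  done

lift_definition minus_padic_int :: "'a padic_int \<Rightarrow> 'a padic_int \<Rightarrow> 'a padic_int"
  is "\<lambda>x y n. (x n - y n) mod int CARD('a) ^ n"
  subgoal for x y n by (rule padic_mod_closed[of "\<lambda>n. x n - y n"]) (metis mod_diff_eq)
  done

lift_definition uminus_padic_int :: "'a padic_int \<Rightarrow> 'a padic_int"
  is "\<lambda>x n. (- x n) mod int CARD('a) ^ n"
  subgoal for x n by (rule padic_mod_closed[of "\<lambda>n. - x n"]) (metis mod_minus_eq)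
  done

lift_definition times_padic_int :: "'a padic_int \<Rightarrow> 'a padic_int \<Rightarrow> 'a padic_int"
  is "\<lambda>x y n. (x n * y n) mod int CARD('a) ^ n"
  subgoal for x y n by (rule padic_mod_closed[of "\<lambda>n. x n * y n"]) (metis mod_mult_eq)
  done

instance
proof
  fix a b c :: "'a padic_int"
  show "a * b * c = a * (b * c)"
    by transfer (simp add: mod_simps mult.assoc)
  show "a * b = b * a"
    by transfer (simp add: mult.commute)
  show "1 * a = a"
    by transfer (simp add: mod_simps)
  show "a + b + c = a + (b + c)"
    by transfer (simp add: mod_simps add.assoc)
  show "a + b = b + a"
    by transfer (simp add: add.commute)
  show "0 + a = a"
    by transfer simp
  show "- a + a = 0"
    by transfer (simp add: mod_simps)
  show "a - b = a + - b"
    by transfer (simp add: mod_simps)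
  show "(a + b) * c = a * c + b * c"
    by transfer (simp add: mod_simps distrib_right)
  have "\<exists>n. (0::int) \<noteq> 1 mod int CARD('a) ^ n"
    using prime_gt_1_nat[OF prime_card[where 'a='a]] by (intro exI[of _ 1]) simp
  then show "(0 :: 'a padic_int) \<noteq> 1"
    by transfer (simp add: fun_eq_iff)
qed

end

instance padic_int :: (prime_card) idom
proof
  fix a b :: "'a padic_int"
  assume "a \<noteq> 0" "b \<noteq> 0"
  let ?p = "int CARD('a)"
  obtain x where x: "a = Abs_padic_int x" and
    x1: "\<forall>n. x n \<in> {0..<?p ^ n} \<and> x (Suc n) mod ?p ^ n = x n"
    by (cases a) auto
  obtain y where y: "b = Abs_padic_int y" and
    y1: "\<forall>n. y n \<in> {0..<?p ^ n} \<and> y (Suc n) mod ?p ^ n = y n"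
    by (cases b) auto
  have rx: "Rep_padic_int a = x" and ry: "Rep_padic_int b = y"
    using x1 y1 by (simp_all add: x y Abs_padic_int_inverse)
  obtain m where m: "x m \<noteq> 0"
    using \<open>a \<noteq> 0\<close> rx by (metis Rep_padic_int_inject zero_padic_int.rep_eq ext)
  obtain n where n: "y n \<noteq> 0"
    using \<open>b \<noteq> 0\<close> ry by (metis Rep_padic_int_inject zero_padic_int.rep_eq ext)
  have "\<not> ?p ^ m dvd x (m + n)"
    using padic_compatible[of m "m + n" x, OF _ x1] m by (auto simp: dvd_eq_mod_eq_0)
  then have vx: "x (m + n) \<noteq> 0" "multiplicity ?p (x (m + n)) < m"
    by (auto, meson multiplicity_dvd' not_le)
  have "\<not> ?p ^ n dvd y (m + n)"
    using padic_compatible[of n "m + n" y, OF _ y1] n by (auto simp: dvd_eq_mod_eq_0)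
  then have vy: "y (m + n) \<noteq> 0" "multiplicity ?p (y (m + n)) < n"
    by (auto, meson multiplicity_dvd' not_le)
  have "multiplicity ?p (x (m + n) * y (m + n)) < m + n"
    using vx vy prime_card_int[where 'a='a]
    by (subst prime_elem_multiplicity_mult_distrib) auto
  then have "\<not> ?p ^ (m + n) dvd x (m + n) * y (m + n)"
    using vx vy prime_card_int[where 'a='a]
    by (metis multiplicity_geI no_zero_divisors not_le not_prime_unit)
  then have "Rep_padic_int (a * b) (m + n) \<noteq> 0"
    by (simp add: times_padic_int.rep_eq rx ry dvd_eq_mod_eq_0)
  then show "a * b \<noteq> 0"
    by (metis zero_padic_int.rep_eq)
qed

type_synonym 'p padic = "'p padic_int fract"

definition padic_of_int :: "'p::prime_card padic_int \<Rightarrow> 'p padic" where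
  "padic_of_int x = Fract x 1"

definition imag_quad_field :: "int \<Rightarrow> complex set" where
  "imag_quad_field \<Delta> = {of_rat a + of_rat b * csqrt (of_int (- \<Delta>)) | a b. True}"

definition imag_quad_integers :: "int \<Rightarrow> complex ring" where
  "imag_quad_integers \<Delta> =
    \<lparr>carrier = {z \<in> imag_quad_field \<Delta>. algebraic_int z}, mult = (*), one = 1, zero = 0, add = (+)\<rparr>"

definition inert_in_imag_quad_field :: "nat \<Rightarrow> int \<Rightarrow> bool" where
  "inert_in_imag_quad_field p \<Delta> \<longleftrightarrow>
    primeideal (PIdl\<^bsub>imag_quad_integers \<Delta>\<^esub> (of_nat p)) (imag_quad_integers \<Delta>)"

definition sign_mat :: "nat \<Rightarrow> nat \<Rightarrow> 'a::comm_ring_1 mat" where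
  "sign_mat r s = mat_diag (r + s) (\<lambda>i. if i < r then 1 else - 1)"

text \<open>
  A pair \<open>(h, k)\<close> of matrices over a ring stands for the matrix \<open>h + k\<surd>d\<close> over the quadratic
  extension by \<open>\<surd>d\<close>. As \<open>p\<close> is inert, \<open>1\<close> and \<open>\<surd>-\<Delta>\<close> form a basis of \<open>\<int>\<^sub>p[\<surd>-\<Delta>]\<close> over \<open>\<int>\<^sub>p\<close>, so that
  equality of such matrices is equality of pairs.
\<close>

fun qext_mult :: "'a::comm_ring_1 \<Rightarrow> 'a mat \<times> 'a mat \<Rightarrow> 'a mat \<times> 'a mat \<Rightarrow> 'a mat \<times> 'a mat" where
  "qext_mult d (h, k) (h', k') = (h * h' + d \<cdot>\<^sub>m (k * k'), h * k' + k * h')"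

fun qext_conj :: "'a::comm_ring_1 mat \<times> 'a mat \<Rightarrow> 'a mat \<times> 'a mat" where
  "qext_conj (h, k) = (h, - k)"

fun qext_transpose :: "'a::comm_ring_1 mat \<times> 'a mat \<Rightarrow> 'a mat \<times> 'a mat" where
  "qext_transpose (h, k) = (h\<^sup>T, k\<^sup>T)"

fun qext_smult :: "'a::comm_ring_1 \<Rightarrow> 'a mat \<times> 'a mat \<Rightarrow> 'a mat \<times> 'a mat" where
  "qext_smult c (h, k) = (c \<cdot>\<^sub>m h, c \<cdot>\<^sub>m k)"

definition qext_sign_mat :: "nat \<Rightarrow> nat \<Rightarrow> 'a::comm_ring_1 mat \<times> 'a mat" where
  "qext_sign_mat r s = (sign_mat r s, 0\<^sub>m (r + s) (r + s))"

text \<open>In these groups, \<open>c dvd 1\<close> says that the multiplier \<open>c\<close> is a unit.\<close>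

definition GV :: "nat \<Rightarrow> nat \<Rightarrow> int \<Rightarrow> ('p::prime_card padic_int mat \<times> 'p padic_int mat) set" where
  "GV r s \<Delta> = {\<gg> \<in> carrier_mat (r + s) (r + s) \<times> carrier_mat (r + s) (r + s).
    \<exists>c. c dvd 1 \<and>
      qext_mult (of_int (- \<Delta>)) (qext_mult (of_int (- \<Delta>)) \<gg> (qext_sign_mat r s))
        (qext_transpose (qext_conj \<gg>)) = qext_smult c (qext_sign_mat r s)}"

definition symplectic_form :: "nat \<Rightarrow> 'a::comm_ring_1 mat" where
  "symplectic_form g = four_block_mat (0\<^sub>m g g) (1\<^sub>m g) (- 1\<^sub>m g) (0\<^sub>m g g)"

definition GSp :: "nat \<Rightarrow> 'a::comm_ring_1 mat set" where
  "GSp g = {M \<in> carrier_mat (2 * g) (2 * g).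
    \<exists>c. c dvd 1 \<and> M * symplectic_form g * M\<^sup>T = c \<cdot>\<^sub>m symplectic_form g}"

fun alpha :: "nat \<Rightarrow> nat \<Rightarrow> int \<Rightarrow> 'p::prime_card padic_int mat \<times> 'p padic_int mat \<Rightarrow> 'p padic_int mat"
  where
  "alpha r s \<Delta> (h, k) =
    (let E = sign_mat r s
     in four_block_mat h (k * E) (of_int (- \<Delta>) \<cdot>\<^sub>m (E * k)) (E * h * E))"

definition residue_system :: "nat \<Rightarrow> int set \<Rightarrow> bool" where
  "residue_system p R \<longleftrightarrow> bij_betw (\<lambda>a. a mod int p) R {0..<int p}"

definition sigma :: "nat \<Rightarrow> nat \<Rightarrow> int mat \<Rightarrow> int mat" where
  "sigma p g S = four_block_mat (1\<^sub>m g) S (0\<^sub>m g g) (int p \<cdot>\<^sub>m 1\<^sub>m g)"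

definition S_open :: "nat \<Rightarrow> nat \<Rightarrow> int set \<Rightarrow> int mat set" where
  "S_open p g R = {sigma p g S | S. S \<in> carrier_mat g g \<and> S\<^sup>T = S \<and> elements_mat S \<subseteq> R}"

definition Tmat :: "nat \<Rightarrow> nat \<Rightarrow> int \<Rightarrow> int mat \<Rightarrow> int mat" where
  "Tmat r s \<Delta> S = sign_mat r s + \<Delta> \<cdot>\<^sub>m (S * sign_mat r s * S)"

text \<open>
  The integral matrix \<open>M\<close> is reduced modulo \<open>p\<close> by \<open>map_mat of_int M\<close>. A vector of dimension \<open>2 * g\<close>
  is a row vector \<open>(x, y)\<close>, so that \<open>xE\<close> is \<open>E\<^sup>T *\<^sub>v x\<close>.
\<close>

definition sqrt_act :: "nat \<Rightarrow> nat \<Rightarrow> int \<Rightarrow> 'a::comm_ring_1 vec \<Rightarrow> 'a vec" where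
  "sqrt_act r s \<Delta> v =
    (let E = sign_mat r s; x = vec_first v (r + s); y = vec_last v (r + s)
     in (of_int (- \<Delta>) \<cdot>\<^sub>v (E\<^sup>T *\<^sub>v y)) @\<^sub>v (E\<^sup>T *\<^sub>v x))"

text \<open>The span over the prime field of all \<open>(a + b\<surd>-\<Delta>)w\<close>, for \<open>w\<close> in \<open>W\<close>:\<close>

definition qext_span :: "nat \<Rightarrow> nat \<Rightarrow> int \<Rightarrow> 'a::field vec set \<Rightarrow> 'a vec set" where
  "qext_span r s \<Delta> W = LinearCombinations.module.span class_ring (module_vec TYPE('a) (2 * (r + s)))
    {a \<cdot>\<^sub>v w + b \<cdot>\<^sub>v sqrt_act r s \<Delta> w | a b w. w \<in> W}"

definition subspace_dim :: "nat \<Rightarrow> 'a::field vec set \<Rightarrow> nat" where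
  "subspace_dim n U = vectorspace.dim class_ring ((module_vec TYPE('a) n)\<lparr>carrier := U\<rparr>)"

text \<open>The block matrix is \<open>(1, S)\<close>; its lower blocks have no rows.\<close>

definition W_space :: "nat \<Rightarrow> int mat \<Rightarrow> 'p::prime_card mod_ring vec set" where
  "W_space g S = vec_space.row_space (2 * g)
    (four_block_mat (1\<^sub>m g) (map_mat of_int S) (0\<^sub>m 0 g) (0\<^sub>m 0 g))"

definition D_set :: "'p::prime_card itself \<Rightarrow> nat \<Rightarrow> nat \<Rightarrow> int \<Rightarrow> nat \<Rightarrow> int mat set" where
  "D_set _ r s \<Delta> j = {sigma CARD('p) (r + s) S | S. S \<in> carrier_mat (r + s) (r + s) \<and> S\<^sup>T = S \<and>
    subspace_dim (2 * (r + s)) (qext_span r s \<Delta> (W_space (r + s) S :: 'p mod_ring vec set)) = j}"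

definition D_equivalent :: "'p::prime_card itself \<Rightarrow> nat \<Rightarrow> nat \<Rightarrow> int \<Rightarrow> int mat \<Rightarrow> int mat \<Rightarrow> bool" where
  "D_equivalent _ r s \<Delta> \<sigma>\<^sub>1 \<sigma>\<^sub>2 \<longleftrightarrow>
    (\<exists>\<gg> \<in> (GV r s \<Delta> :: ('p padic_int mat \<times> 'p padic_int mat) set).
      map_mat of_int \<sigma>\<^sub>1 * map_mat padic_of_int (alpha r s \<Delta> \<gg>) * the (mat_inverse (map_mat of_int \<sigma>\<^sub>2))
        \<in> map_mat padic_of_int ` GSp (r + s))"

end

theory Submission
  imports Defs
begin

text \<open>
  Put \<open>d = -\<Delta>\<close>, and read a row vector \<open>(x, y)\<close> as \<open>x + yE\<surd>d\<close>. In these coordinates \<open>\<alpha>(\<gg>)\<close> is right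
  multiplication by \<open>\<gg>\<close>, and the row space of \<open>(1, s)\<close> consists of the vectors \<open>xM(s)\<close> with \<open>x\<close> over the base
  ring and \<open>M(s) = 1 + sE\<surd>d\<close>. Hence \<open>\<sigma>\<^sub>1\<alpha>(\<gg>)\<sigma>\<^sub>2\<^sup>-\<^sup>1\<close> is integral exactly if, modulo
  \<open>p\<close>, \<open>M(s\<^sub>1)\<gg> = NM(s\<^sub>2)\<close> for some matrix \<open>N\<close> without \<open>\<surd>d\<close>. The link with \<open>T\<close> is the identity
  \<open>M(s)EM(s)\<^sup>* = T(s)\<close>: if \<open>\<gg>E\<gg>\<^sup>* = \<lambda>E\<close>, the equation for \<open>\<gg>\<close> becomes the congruence of symmetric matrices
  \<open>NT(s\<^sub>2)N\<^sup>T = \<lambda>T(s\<^sub>1)\<close>.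

  One direction follows by taking determinants modulo \<open>p\<close> (\<open>D_equivalent_imp_det_relation\<close>): for even \<open>g\<close> the
  factor \<open>\<lambda>\<^sup>g\<close> is a square.

  For the other direction, membership in \<open>\<DD>\<^sub>2\<^sub>g\<close> says that \<open>T(s\<^sub>1)\<close> and \<open>T(s\<^sub>2)\<close> are invertible modulo
  \<open>p\<close> (\<open>D_set_full_imp\<close>), hence over \<open>\<int>\<^sub>p\<close>. For odd \<open>p\<close> the determinant modulo squares classifies symmetric
  matrices of unit determinant over \<open>\<int>\<^sub>p\<close> up to congruence (\<open>congruent_if_det_mult_square\<close>), so that the
  congruence can be solved over \<open>\<int>\<^sub>p\<close> itself: with \<open>\<lambda> = 1\<close> if \<open>g\<close> is even and the ratio of the determinants is
  a square, and with \<open>\<lambda> = det T(s\<^sub>1) det T(s\<^sub>2)\<close> if \<open>g\<close> is odd. The matrix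
  \<open>\<gg> = M(s\<^sub>1)\<^sup>-\<^sup>1NM(s\<^sub>2)\<close> is then an exact solution (\<open>D_equivalent_if_congruent\<close>).
  As the congruence is solved over \<open>\<int>\<^sub>p\<close> from the start, no element of a unitary group has to be lifted from
  residues; lifting is confined to quadratic equations
  in one variable (\<open>quadratic_hensel\<close>).
\<close>

section \<open>Congruence of symmetric matrices\<close>

definition congruent_mat :: "nat \<Rightarrow> 'a::comm_ring_1 mat \<Rightarrow> 'a mat \<Rightarrow> bool" where
  "congruent_mat n A B \<longleftrightarrow> (\<exists>P \<in> carrier_mat n n. det P dvd 1 \<and> P * A * P\<^sup>T = B)"

lemma mat_inverse_of_unit_det:
  assumes "A \<in> carrier_mat n n" and "det A dvd 1"
  obtains B where "B \<in> carrier_mat n n" "A * B = 1\<^sub>m n" "B * A = 1\<^sub>m n"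
proof -
  obtain u where u: "1 = det A * u"
    using assms(2) ..
  note adj = adj_mat[OF assms(1)]
  show thesis
  proof
    show "u \<cdot>\<^sub>m adj_mat A \<in> carrier_mat n n"
      using adj by simp
    show "A * (u \<cdot>\<^sub>m adj_mat A) = 1\<^sub>m n"
      using adj u by (subst mult_smult_distrib[OF assms(1) adj(1)]) (auto intro!: eq_matI simp: mult.commute)
    show "u \<cdot>\<^sub>m adj_mat A * A = 1\<^sub>m n"
      using adj u by (subst mult_smult_assoc_mat[OF adj(1) assms(1)]) (auto intro!: eq_matI simp: mult.commute)
  qed
qed

lemma congruent_mat_refl:
  assumes "A \<in> carrier_mat n n"
  shows "congruent_mat n A A"
  unfolding congruent_mat_def using assms by (intro bexI[of _ "1\<^sub>m n"]) auto

lemma congruent_mat_trans: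
  assumes "A \<in> carrier_mat n n" and "congruent_mat n A B" and "congruent_mat n B C"
  shows "congruent_mat n A C"
proof -
  from assms obtain P Q where P: "P \<in> carrier_mat n n" "det P dvd 1" "P * A * P\<^sup>T = B"
    and Q: "Q \<in> carrier_mat n n" "det Q dvd 1" "Q * B * Q\<^sup>T = C"
    unfolding congruent_mat_def by blast
  have "(Q * P) * A * (Q * P)\<^sup>T = C"
    unfolding P(3)[symmetric] Q(3)[symmetric] using P(1) Q(1) assms(1)
    by (simp add: transpose_mult[of _ n n _ n] assoc_mult_mat[of _ n n _ n _ n])
  moreover have "det (Q * P) dvd 1"
    using P Q by (simp add: det_mult[of _ n] mult_unit_dvd_iff)
  ultimately show ?thesis
    unfolding congruent_mat_def using P Q by (intro bexI[of _ "Q * P"]) auto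
qed

lemma congruent_mat_sym:
  assumes "A \<in> carrier_mat n n" and "congruent_mat n A B"
  shows "congruent_mat n B A"
proof -
  from assms obtain P where P: "P \<in> carrier_mat n n" "det P dvd 1" "P * A * P\<^sup>T = B"
    unfolding congruent_mat_def by blast
  obtain Q where Q: "Q \<in> carrier_mat n n" "P * Q = 1\<^sub>m n" "Q * P = 1\<^sub>m n"
    using mat_inverse_of_unit_det[OF P(1,2)] by metis
  have "det P * det Q = 1"
    using P(1) Q by (simp flip: det_mult)
  then have "det Q dvd 1"
    by (metis dvd_triv_right)
  have "Q * B * Q\<^sup>T = (Q * P) * A * (Q * P)\<^sup>T"
    unfolding P(3)[symmetric] using P(1) Q(1) assms(1)
    by (simp add: transpose_mult[of _ n n _ n] assoc_mult_mat[of _ n n _ n _ n])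
  also have "\<dots> = A"
    using Q(3) assms(1) by simp
  finally show ?thesis
    unfolding congruent_mat_def using Q \<open>det Q dvd 1\<close> by blast
qed

lemma congruent_mat_det:
  assumes "A \<in> carrier_mat n n" and "congruent_mat n A B"
  obtains u where "u dvd 1" "det B = u\<^sup>2 * det A"
proof -
  from assms obtain P where P: "P \<in> carrier_mat n n" "det P dvd 1" "P * A * P\<^sup>T = B"
    unfolding congruent_mat_def by blast
  have "det B = det P * det A * det P"
    unfolding P(3)[symmetric] using P(1) assms(1) by (simp add: det_mult[of _ n] det_transpose)
  then show thesis
    using that P(2) by (simp add: power2_eq_square mult_ac)
qed

lemma congruent_mat_unit_det:
  assumes "A \<in> carrier_mat n n" and "congruent_mat n A B" and "det A dvd 1"
  shows "det B dvd 1"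
proof -
  obtain u where u: "u dvd 1" "det B = u\<^sup>2 * det A"
    using congruent_mat_det[OF assms(1,2)] .
  have "u * u * det A dvd 1 * 1 * 1"
    by (intro mult_dvd_mono u assms(3))
  then show ?thesis
    by (simp add: u power2_eq_square)
qed

text \<open>
  The determinant of \<open>P\<close> divides that of \<open>PAP\<^sup>T\<close>, so for a target of unit determinant the invertibility of
  \<open>P\<close> comes for free.
\<close>

lemma congruent_matI:
  assumes "A \<in> carrier_mat n n" and "P \<in> carrier_mat n n" and "P * A * P\<^sup>T = B" and "det B dvd 1"
  shows "congruent_mat n A B"
proof -
  have "det B = det P * (det A * det P)"
    unfolding assms(3)[symmetric] using assms(1,2) by (simp add: det_mult[of _ n] det_transpose)
  then have "det P dvd 1"
    using assms(4) by (metis dvd_mult_left)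
  then show ?thesis
    unfolding congruent_mat_def using assms by blast
qed

lemma symmetric_congruence:
  fixes A :: "'a::comm_ring_1 mat"
  assumes "A \<in> carrier_mat n n" and "A\<^sup>T = A" and "P \<in> carrier_mat n n"
  shows "(P * A * P\<^sup>T)\<^sup>T = P * A * P\<^sup>T"
  using assms
  by (simp add: transpose_mult[of _ n n _ n] assoc_mult_mat[of _ n n _ n _ n] mult_carrier_mat[of _ n n _ n])

definition block_sum :: "nat \<Rightarrow> nat \<Rightarrow> 'a::zero mat \<Rightarrow> 'a mat \<Rightarrow> 'a mat" where
  "block_sum m n A B = four_block_mat A (0\<^sub>m m n) (0\<^sub>m n m) B"

lemma block_sum_carrier [simp]:
  "A \<in> carrier_mat m m \<Longrightarrow> B \<in> carrier_mat n n \<Longrightarrow> block_sum m n A B \<in> carrier_mat (m + n) (m + n)"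
  by (simp add: block_sum_def)

lemma block_sum_mult:
  assumes "A \<in> carrier_mat m m" "B \<in> carrier_mat n n" "C \<in> carrier_mat m m" "D \<in> carrier_mat n n"
  shows "block_sum m n A B * block_sum m n C D = block_sum m n (A * C) (B * D)"
  unfolding block_sum_def using assms
  by (subst mult_four_block_mat[of _ m m _ n _ n _ _ m _ n]) auto

lemma block_sum_transpose:
  assumes "A \<in> carrier_mat m m" "B \<in> carrier_mat n n"
  shows "(block_sum m n A B)\<^sup>T = block_sum m n A\<^sup>T B\<^sup>T"
  unfolding block_sum_def using assms
  by (subst transpose_four_block_mat[of _ m m _ n _ n]) auto

lemma det_block_sum:
  fixes A :: "'a::idom mat"
  assumes "A \<in> carrier_mat m m" "B \<in> carrier_mat n n"
  shows "det (block_sum m n A B) = det A * det B"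
  unfolding block_sum_def using assms by (intro det_four_block_mat_lower_left_zero) auto

lemma congruent_block_sum:
  fixes A :: "'a::idom mat"
  assumes "A \<in> carrier_mat m m" "C \<in> carrier_mat n n"
    and "congruent_mat m A B" "congruent_mat n C D"
  shows "congruent_mat (m + n) (block_sum m n A C) (block_sum m n B D)"
proof -
  from assms obtain P Q where P: "P \<in> carrier_mat m m" "det P dvd 1" "P * A * P\<^sup>T = B"
    and Q: "Q \<in> carrier_mat n n" "det Q dvd 1" "Q * C * Q\<^sup>T = D"
    unfolding congruent_mat_def by blast
  have "block_sum m n P Q * block_sum m n A C * (block_sum m n P Q)\<^sup>T = block_sum m n B D"
    using P Q assms(1,2) by (simp add: block_sum_transpose block_sum_mult)
  moreover have "det (block_sum m n P Q) dvd 1"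
    using P Q by (simp add: det_block_sum mult_unit_dvd_iff)
  ultimately show ?thesis
    unfolding congruent_mat_def using P(1) Q(1) by (intro bexI[of _ "block_sum m n P Q"]) auto
qed

lemma block_sum_mat_diag:
  "block_sum m n (mat_diag m f) (mat_diag n h) = mat_diag (m + n) (\<lambda>i. if i < m then f i else h (i - m))"
  by (rule eq_matI) (auto simp: block_sum_def mat_diag_def)

lemma det_mat_diag: "det (mat_diag n f) = (\<Prod>i<n. f i)"
proof -
  have "det (mat_diag n f) = prod_list (diag_mat (mat_diag n f))"
    by (rule det_upper_triangular[of _ n]) (auto simp: mat_diag_def)
  also have "diag_mat (mat_diag n f) = map f [0..<n]"
    by (auto simp: diag_mat_def mat_diag_def)
  finally show ?thesis
    by (simp add: prod.list_conv_set_nth interv_sum_list_conv_sum_set_nat lessThan_atLeast0)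
qed

lemma transpose_mat_diag [simp]: "(mat_diag n f)\<^sup>T = mat_diag n f"
  by (rule eq_matI) (auto simp: mat_diag_def)

text \<open>
  One step of Gaussian elimination: a unit in the corner clears its row and, by symmetry, its column.
\<close>

lemma schur_complement_congruence:
  fixes A :: "'a::idom mat"
  assumes A: "A \<in> carrier_mat (1 + n) (1 + n)" "A\<^sup>T = A" and a: "A $$ (0, 0) dvd 1"
  shows "\<exists>D \<in> carrier_mat n n. D\<^sup>T = D \<and>
    congruent_mat (1 + n) A (block_sum 1 n (mat_diag 1 (\<lambda>_. A $$ (0, 0))) D)"
proof -
  note One_nat_def [simp del]
  let ?a = "A $$ (0, 0)"
  obtain u where u: "1 = ?a * u"
    using a ..
  define c where "c = mat n 1 (\<lambda>(i, j). A $$ (i + 1, 0))"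
  define B where "B = mat n n (\<lambda>(i, j). A $$ (i + 1, j + 1))"
  have c: "c \<in> carrier_mat n 1" and B: "B \<in> carrier_mat n n"
    by (simp_all add: c_def B_def)
  have sym: "A $$ (i, j) = A $$ (j, i)" if "i < 1 + n" "j < 1 + n" for i j
    using A that by (metis carrier_matD index_transpose_mat(1))
  have blocks: "A = four_block_mat (mat_diag 1 (\<lambda>_. ?a)) c\<^sup>T c B"
    using A by (intro eq_matI) (auto simp: c_def B_def mat_diag_def sym not_less)
  define X where "X = (- u) \<cdot>\<^sub>m c"
  have X: "X \<in> carrier_mat n 1"
    using c by (simp add: X_def)
  define P where "P = four_block_mat (1\<^sub>m 1) (0\<^sub>m 1 n) X (1\<^sub>m n)"
  have cancel: "X * mat_diag 1 (\<lambda>_. ?a) + c = 0\<^sub>m n 1"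
  proof -
    have "- u * x * ?a + x = x * (1 - ?a * u)" for x
      by (simp add: algebra_simps)
    then have "x = u * x * ?a" for x
      by (simp flip: u add: add_eq_0_iff eq_neg_iff_add_eq_0)
    then show ?thesis
      unfolding mat_diag_mult_right[OF X] by (intro eq_matI) (auto simp: X_def c_def)
  qed
  note diag1 = left_mult_one_mat[OF mat_diag_dim] right_mult_one_mat[OF mat_diag_dim]
    right_add_zero_mat[OF mat_diag_dim]
  define D where "D = X * c\<^sup>T + B"
  have D: "D \<in> carrier_mat n n"
    using c B X by (auto simp: D_def intro!: mult_carrier_mat)
  have PA: "P * A = four_block_mat (mat_diag 1 (\<lambda>_. ?a)) c\<^sup>T (0\<^sub>m n 1) D"
    unfolding P_def by (subst blocks, subst mult_four_block_mat[of _ 1 1 _ n _ n _ _ 1 _ n])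
      (use c B X in \<open>auto simp: diag1 cancel D_def\<close>)
  have PT: "P\<^sup>T = four_block_mat (1\<^sub>m 1) X\<^sup>T (0\<^sub>m n 1) (1\<^sub>m n)"
    unfolding P_def by (subst transpose_four_block_mat[of _ 1 1 _ n _ n]) (use X in auto)
  have cancel': "mat_diag 1 (\<lambda>_. ?a) * X\<^sup>T + c\<^sup>T = 0\<^sub>m 1 n"
    using arg_cong[OF cancel, of transpose_mat]
    using c X by (simp add: transpose_add[of _ n 1] transpose_mult[of _ n 1 _ 1] mult_carrier_mat[of _ n 1 _ 1])
  have PAP: "P * A * P\<^sup>T = block_sum 1 n (mat_diag 1 (\<lambda>_. ?a)) D"
    unfolding PA PT block_sum_def
    by (subst mult_four_block_mat[of _ 1 1 _ n _ n _ _ 1 _ n]) (use c X D in \<open>auto simp: diag1 cancel'\<close>)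
  have P: "P \<in> carrier_mat (1 + n) (1 + n)" "det P = 1"
    unfolding P_def using X by (auto simp: det_four_block_mat_upper_right_zero[of _ 1 _ n])
  have "D = (- u) \<cdot>\<^sub>m (c * c\<^sup>T) + B"
    unfolding D_def X_def using c by (subst mult_smult_assoc_mat[OF c, of _ n]) auto
  moreover have "B\<^sup>T = B"
    by (rule eq_matI) (auto simp: B_def sym)
  moreover have "(c * c\<^sup>T)\<^sup>T = c * c\<^sup>T"
    using c by (simp add: transpose_mult[of _ n 1 _ n])
  moreover have "(k \<cdot>\<^sub>m M)\<^sup>T = k \<cdot>\<^sub>m M\<^sup>T" for k and M :: "'a mat"
    by (rule eq_matI) auto
  ultimately have "D\<^sup>T = D"
    using B c by (simp add: transpose_add[of _ n n] mult_carrier_mat[of _ n 1 _ n])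
  then show ?thesis
    using D P PAP unfolding congruent_mat_def by (intro bexI[of _ D] conjI bexI[of _ P]) auto
qed

text \<open>
  These are the properties of \<open>\<int>\<^sub>p\<close>, for odd \<open>p\<close>, on which the classification of symmetric matrices of unit
  determinant rests: it is local, \<open>2\<close> is a unit, and binary forms with unit coefficients represent \<open>1\<close>.
\<close>

locale universal_local_ring =
  fixes R :: "'a::idom itself"
  assumes unit_of_sum: "\<And>x y :: 'a. x + y dvd 1 \<Longrightarrow> x dvd 1 \<or> y dvd 1"
    and two_unit: "(2 :: 'a) dvd 1"
    and binary_form_one: "\<And>a b :: 'a. a dvd 1 \<Longrightarrow> b dvd 1 \<Longrightarrow> \<exists>x y. a * x\<^sup>2 + b * y\<^sup>2 = 1"
begin

lemma unit_summand:
  fixes f :: "'b \<Rightarrow> 'a"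
  assumes "finite I" and "(\<Sum>i\<in>I. f i) dvd 1"
  shows "\<exists>i\<in>I. f i dvd 1"
  using assms
proof (induction I rule: finite_induct)
  case (insert i I)
  then show ?case
    using unit_of_sum[of "f i" "sum f I"] by auto
qed simp

text \<open>
  By Laplace expansion along row \<open>0\<close> some entry \<open>A\<^sub>0\<^sub>j\<close> is a unit. Adding \<open>a\<close> times row and column \<open>j\<close> to row and
  column \<open>0\<close> turns the corner into \<open>A\<^sub>0\<^sub>0 + 2aA\<^sub>0\<^sub>j + a\<^sup>2A\<^sub>j\<^sub>j\<close>. The values for \<open>a = 1\<close> and \<open>a = -1\<close> differ by the
  unit \<open>4A\<^sub>0\<^sub>j\<close>, so they cannot both be non-units.
\<close>

lemma congruent_unit_corner:
  fixes A :: "'a mat"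
  assumes A: "A \<in> carrier_mat (Suc n) (Suc n)" "A\<^sup>T = A" "det A dvd 1"
  shows "\<exists>B \<in> carrier_mat (Suc n) (Suc n). B\<^sup>T = B \<and> B $$ (0, 0) dvd 1 \<and> congruent_mat (Suc n) A B"
proof (cases "A $$ (0, 0) dvd 1")
  case True
  then show ?thesis
    using A congruent_mat_refl by blast
next
  case False
  have "(\<Sum>j<Suc n. A $$ (0, j) * cofactor A 0 j) dvd 1"
    using laplace_expansion_row[OF A(1), of 0] A(3) by simp
  then obtain j where j: "j < Suc n" "A $$ (0, j) * cofactor A 0 j dvd 1"
    using unit_summand[of "{..<Suc n}"] by blast
  then have unit: "A $$ (0, j) dvd 1"
    by (metis dvd_mult_left)
  with False have "j \<noteq> 0"
    by metis
  have sym: "A $$ (j, 0) = A $$ (0, j)"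
    using A j by (metis carrier_matD index_transpose_mat(1) zero_less_Suc)
  define B where "B a = addrow_mat (Suc n) a 0 j * A * (addrow_mat (Suc n) a 0 j)\<^sup>T" for a
  have corner: "B a $$ (0, 0) = A $$ (0, 0) + 2 * a * A $$ (0, j) + a\<^sup>2 * A $$ (j, j)" for a
  proof -
    have "B a = (addrow a 0 j (addrow a 0 j A)\<^sup>T)\<^sup>T"
      unfolding B_def using A j
      by (simp add: addrow_mat[of _ "Suc n" "Suc n"] transpose_mult[of _ "Suc n" "Suc n" _ "Suc n"]
          assoc_mult_mat[of _ "Suc n" "Suc n" _ "Suc n" _ "Suc n"])
    then show ?thesis
      using A(1) j \<open>j \<noteq> 0\<close> sym by (simp add: algebra_simps power2_eq_square)
  qed
  have "(4 :: 'a) dvd 1"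
    using two_unit mult_dvd_mono[of 2 1 "2 :: 'a" 1] by simp
  then have "4 * A $$ (0, j) dvd 1"
    using mult_dvd_mono[OF _ unit, of 4 1] by simp
  moreover have "4 * A $$ (0, j) = B 1 $$ (0, 0) + - (B (- 1) $$ (0, 0))"
    by (simp add: corner)
  ultimately have "B 1 $$ (0, 0) dvd 1 \<or> B (- 1) $$ (0, 0) dvd 1"
    using unit_of_sum[of "B 1 $$ (0, 0)" "- (B (- 1) $$ (0, 0))"] by simp
  then obtain a where a: "B a $$ (0, 0) dvd 1"
    by blast
  have "congruent_mat (Suc n) A (B a)"
    unfolding congruent_mat_def B_def using j \<open>j \<noteq> 0\<close>
    by (intro bexI[of _ "addrow_mat (Suc n) a 0 j"]) (auto simp: det_addrow_mat)
  moreover have "(B a)\<^sup>T = B a" "B a \<in> carrier_mat (Suc n) (Suc n)"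
    unfolding B_def using A by (auto intro!: symmetric_congruence mult_carrier_mat)
  ultimately show ?thesis
    using a by blast
qed

text \<open>
  If \<open>ax\<^sup>2 + by\<^sup>2 = 1\<close>, then \<open>(x, y)\<close> has norm \<open>1\<close>, and \<open>(-by, ax)\<close> is orthogonal to it with norm \<open>ab\<close>.
\<close>

lemma congruent_binary_diag:
  fixes a b :: 'a
  assumes "a dvd 1" and "b dvd 1"
  shows "congruent_mat 2 (mat_diag 2 (\<lambda>i. if i = 0 then a else b)) (mat_diag 2 (\<lambda>i. if i = 0 then a * b else 1))"
proof -
  obtain x y where xy: "a * x\<^sup>2 + b * y\<^sup>2 = 1"
    using binary_form_one assms by blast
  define P where "P = mat 2 2 (\<lambda>(i, j). if i = 0 then if j = 0 then - b * y else a * x else if j = 0 then x else y)"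
  have eq: "P * mat_diag 2 (\<lambda>i. if i = 0 then a else b) * P\<^sup>T = mat_diag 2 (\<lambda>i. if i = 0 then a * b else 1)"
  proof -
    have "a * (a * (b * (x * x))) + a * (b * (b * (y * y))) = a * b * (a * x\<^sup>2 + b * y\<^sup>2)"
      by (simp add: algebra_simps power2_eq_square)
    then have "a * (a * (b * (x * x))) + a * (b * (b * (y * y))) = a * b"
      using xy by simp
    then show ?thesis
      using xy by (intro eq_matI)
        (auto simp: mat_diag_mult_right[of _ 2 2] P_def scalar_prod_def numeral_2_eq_2 less_Suc_eq
          mat_diag_def algebra_simps power2_eq_square)
  qed
  show ?thesis
  proof (rule congruent_matI[OF _ _ eq])
    show "det (mat_diag 2 (\<lambda>i. if i = 0 then a * b else 1)) dvd 1"
      using assms by (simp add: det_mat_diag numeral_2_eq_2 mult_unit_dvd_iff)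
  qed (simp_all add: P_def)
qed

text \<open>
  Splitting off a unit corner leaves a matrix that is congruent to \<open>diag(d, 1, \<dots>, 1)\<close> by induction; the corner is
  then merged into \<open>d\<close>.
\<close>

lemma congruent_normal_form:
  fixes A :: "'a mat"
  assumes "A \<in> carrier_mat (Suc n) (Suc n)" "A\<^sup>T = A" "det A dvd 1"
  shows "\<exists>d. congruent_mat (Suc n) A (mat_diag (Suc n) (\<lambda>i. if i = 0 then d else 1))"
  using assms
proof (induction n arbitrary: A)
  case 0
  then have "A = mat_diag (Suc 0) (\<lambda>i. if i = 0 then A $$ (0, 0) else 1)"
    by (intro eq_matI) (auto simp: mat_diag_def)
  then show ?case
    using congruent_mat_refl[OF 0(1)] by metis
next
  case (Suc n)
  obtain B where B: "B \<in> carrier_mat (Suc (Suc n)) (Suc (Suc n))" "B\<^sup>T = B" "B $$ (0, 0) dvd 1"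
    "congruent_mat (Suc (Suc n)) A B"
    using congruent_unit_corner[OF Suc.prems] by blast
  let ?b = "B $$ (0, 0)"
  obtain D where D: "D \<in> carrier_mat (Suc n) (Suc n)" "D\<^sup>T = D"
    "congruent_mat (Suc (Suc n)) B (block_sum 1 (Suc n) (mat_diag 1 (\<lambda>_. ?b)) D)"
    using schur_complement_congruence[of B "Suc n"] B by auto
  have AD: "congruent_mat (Suc (Suc n)) A (block_sum 1 (Suc n) (mat_diag 1 (\<lambda>_. ?b)) D)"
    using congruent_mat_trans Suc.prems(1) B(4) D(3) by blast
  then have "det (block_sum 1 (Suc n) (mat_diag 1 (\<lambda>_. ?b)) D) dvd 1"
    using congruent_mat_unit_det Suc.prems(1,3) by blast
  then have "det (mat_diag 1 (\<lambda>_. ?b)) * det D dvd 1"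
    by (simp only: det_block_sum[OF mat_diag_dim D(1)])
  then have "det D dvd 1"
    by (rule dvd_mult_right)
  then obtain d where d: "congruent_mat (Suc n) D (mat_diag (Suc n) (\<lambda>i. if i = 0 then d else 1))"
    using Suc.IH D by blast
  have "det (mat_diag (Suc n) (\<lambda>i. if i = 0 then d else 1)) = d"
    by (simp add: det_mat_diag prod.lessThan_Suc_shift del: prod.lessThan_Suc)
  then have "d dvd 1"
    using congruent_mat_unit_det[OF D(1) d \<open>det D dvd 1\<close>] by simp
  have "congruent_mat (1 + Suc n) (block_sum 1 (Suc n) (mat_diag 1 (\<lambda>_. ?b)) D)
      (block_sum 1 (Suc n) (mat_diag 1 (\<lambda>_. ?b)) (mat_diag (Suc n) (\<lambda>i. if i = 0 then d else 1)))"
    using D(1) d by (intro congruent_block_sum congruent_mat_refl) auto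
  also have "block_sum 1 (Suc n) (mat_diag 1 (\<lambda>_. ?b)) (mat_diag (Suc n) (\<lambda>i. if i = 0 then d else 1))
      = block_sum 2 n (mat_diag 2 (\<lambda>i. if i = 0 then ?b else d)) (mat_diag n (\<lambda>_. 1))"
    unfolding block_sum_mat_diag by (rule eq_matI) (auto simp: mat_diag_def)
  finally have 1: "congruent_mat (Suc (Suc n)) (block_sum 1 (Suc n) (mat_diag 1 (\<lambda>_. ?b)) D)
    (block_sum 2 n (mat_diag 2 (\<lambda>i. if i = 0 then ?b else d)) (mat_diag n (\<lambda>_. 1)))"
    by simp
  have "congruent_mat (2 + n) (block_sum 2 n (mat_diag 2 (\<lambda>i. if i = 0 then ?b else d)) (mat_diag n (\<lambda>_. 1)))
    (block_sum 2 n (mat_diag 2 (\<lambda>i. if i = 0 then ?b * d else 1)) (mat_diag n (\<lambda>_. 1)))"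
    using B(3) \<open>d dvd 1\<close> by (intro congruent_block_sum congruent_mat_refl congruent_binary_diag) auto
  also have "block_sum 2 n (mat_diag 2 (\<lambda>i. if i = 0 then ?b * d else 1)) (mat_diag n (\<lambda>_. 1))
      = mat_diag (Suc (Suc n)) (\<lambda>i. if i = 0 then ?b * d else 1)"
    unfolding block_sum_mat_diag by (rule eq_matI) (auto simp: mat_diag_def)
  finally have 2: "congruent_mat (Suc (Suc n))
      (block_sum 2 n (mat_diag 2 (\<lambda>i. if i = 0 then ?b else d)) (mat_diag n (\<lambda>_. 1)))
      (mat_diag (Suc (Suc n)) (\<lambda>i. if i = 0 then ?b * d else 1))"
    by simp
  show ?case
    using congruent_mat_trans[OF Suc.prems(1) congruent_mat_trans[OF Suc.prems(1) AD 1] 2] by blast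
qed

text \<open>
  The hypothesis on the product says that the two determinants, being units, agree modulo squares.
\<close>

lemma congruent_if_det_mult_square:
  fixes A B :: "'a mat"
  assumes A: "A \<in> carrier_mat n n" "A\<^sup>T = A" "det A dvd 1"
    and B: "B \<in> carrier_mat n n" "B\<^sup>T = B" "det B dvd 1"
    and sq: "det A * det B = w\<^sup>2"
  shows "congruent_mat n A B"
proof (cases n)
  case 0
  then have "A = B"
    using A(1) B(1) by (intro eq_matI) auto
  then show ?thesis
    using congruent_mat_refl A(1) by metis
next
  case (Suc m)
  let ?F = "\<lambda>d. mat_diag n (\<lambda>i. if i = 0 then d else 1)"
  have detF: "det (?F d) = d" for d :: 'a
    by (simp add: det_mat_diag Suc prod.lessThan_Suc_shift del: prod.lessThan_Suc)
  obtain d e where d: "congruent_mat n A (?F d)" and e: "congruent_mat n B (?F e)"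
    using congruent_normal_form[of A m] congruent_normal_form[of B m] A B Suc by auto
  obtain u where u: "u dvd 1" "d = u\<^sup>2 * det A"
    by (rule congruent_mat_det[OF A(1) d, unfolded detF])
  obtain v where v: "v dvd 1" "e = v\<^sup>2 * det B"
    by (rule congruent_mat_det[OF B(1) e, unfolded detF])
  have "d dvd 1" "e dvd 1"
    using congruent_mat_unit_det[OF A(1) d A(3)] congruent_mat_unit_det[OF B(1) e B(3)] detF by simp_all
  then obtain d' where d': "1 = d * d'"
    by blast
  define z where "z = u * v * w"
  have "d * e = z\<^sup>2"
  proof -
    have "d * e = u\<^sup>2 * v\<^sup>2 * (det A * det B)"
      unfolding u(2) v(2) by (simp only: mult_ac)
    then show ?thesis
      by (simp only: sq z_def power_mult_distrib)
  qed
  \<comment> \<open>As \<open>de = z\<^sup>2\<close>, scaling the first basis vector by \<open>z/d\<close> turns \<open>d\<close> into \<open>z\<^sup>2/d = e\<close>.\<close>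
  have scale: "z * d' * d * (z * d') = e"
  proof -
    have "z * d' * d * (z * d') = z\<^sup>2 * d' * (d * d')"
      by (simp add: power2_eq_square)
    also have "\<dots> = e * (d * d') * (d * d')"
      unfolding \<open>d * e = z\<^sup>2\<close>[symmetric] by (simp only: mult_ac)
    finally show ?thesis
      using d' by simp
  qed
  have eq: "?F (z * d') * ?F d * (?F (z * d'))\<^sup>T = ?F e"
    unfolding transpose_mat_diag mat_diag_diag
    by (rule arg_cong[of _ _ "mat_diag n"]) (simp add: fun_eq_iff scale)
  have "congruent_mat n (?F d) (?F e)"
    by (rule congruent_matI[OF _ _ eq]) (simp_all add: detF \<open>e dvd 1\<close>)
  then show ?thesis
    by (rule congruent_mat_trans[OF A(1) congruent_mat_trans[OF A(1) d] congruent_mat_sym[OF B(1) e]])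
qed

end

section \<open>Squares and units in the p-adic integers\<close>

text \<open>
  Newton's step: \<open>t\<close> cancels the error modulo one more power of \<open>q\<close>, because the derivative is invertible
  modulo \<open>q\<close>.
\<close>

lemma quadratic_hensel_step:
  fixes q A B C x :: int
  assumes "prime q" and "n \<ge> 1" and "q ^ n dvd A * x\<^sup>2 + B * x + C" and "\<not> q dvd 2 * A * x + B"
  shows "\<exists>t. q ^ Suc n dvd A * (x + q ^ n * t)\<^sup>2 + B * (x + q ^ n * t) + C"
proof -
  obtain e where e: "A * x\<^sup>2 + B * x + C = q ^ n * e"
    using assms(3) by blast
  have "coprime (2 * A * x + B) q"
    using assms(1,4) by (metis coprime_commute prime_imp_coprime)
  then obtain w where "[(2 * A * x + B) * w = 1] (mod q)"
    using cong_solve_coprime_int by blast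
  then have w: "q dvd (2 * A * x + B) * w - 1"
    by (simp add: cong_iff_dvd_diff)
  define t where "t = - e * w"
  have "A * (x + q ^ n * t)\<^sup>2 + B * (x + q ^ n * t) + C
      = q ^ n * (e + (2 * A * x + B) * t + A * q ^ n * t\<^sup>2)"
    using e by (simp add: power2_eq_square algebra_simps)
  moreover have "q dvd e + (2 * A * x + B) * t + A * q ^ n * t\<^sup>2"
  proof -
    have "e + (2 * A * x + B) * t = - e * ((2 * A * x + B) * w - 1)"
      by (simp add: t_def algebra_simps)
    moreover have "q dvd q ^ n"
      using assms(2) by (simp add: dvd_power)
    ultimately show ?thesis
      using w by (metis dvd_add dvd_mult dvd_mult2)
  qed
  ultimately show ?thesis
    by (metis mult_dvd_mono dvd_refl power_Suc2)
qed

lemma of_int_mod_card [simp]: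
  "(of_int (a mod int CARD('p)) :: 'p::prime_card mod_ring) = of_int a"
  using of_int_mod_CHAR[where 'a="'p mod_ring"] by simp

lemma of_int_mod_ring_eq_0_iff: "(of_int a :: 'p::prime_card mod_ring) = 0 \<longleftrightarrow> int CARD('p) dvd a"
  by (metis of_int_eq_iff_cong_CHAR semiring_char_mod_ring of_int_0 cong_0_iff)

definition padic_residue :: "'p::prime_card padic_int \<Rightarrow> 'p mod_ring" where
  "padic_residue x = of_int (Rep_padic_int x 1)"

interpretation padic_residue: comm_ring_hom "padic_residue :: 'p::prime_card padic_int \<Rightarrow> 'p mod_ring"
proof
  fix x y :: "'p padic_int"
  show "padic_residue (x + y) = padic_residue x + padic_residue y"
    by (simp add: padic_residue_def plus_padic_int.rep_eq)
  show "padic_residue (x * y) = padic_residue x * padic_residue y"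
    by (simp add: padic_residue_def times_padic_int.rep_eq)
  show "padic_residue 0 = (0 :: 'p mod_ring)"
    by (simp add: padic_residue_def zero_padic_int.rep_eq)
  show "padic_residue 1 = (1 :: 'p mod_ring)"
    using of_int_mod_card[of 1, where 'p='p]
    by (simp add: padic_residue_def one_padic_int.rep_eq del: of_int_mod_card)
qed

lemma padic_residue_surj: "\<exists>x. padic_residue x = a"
proof -
  obtain i where "a = of_nat i"
    using surj_of_nat_mod_ring by blast
  then have "padic_residue (of_nat i) = a"
    by (simp add: padic_residue.hom_of_nat)
  then show ?thesis ..
qed

lemma Rep_padic_int_mod: "Rep_padic_int (x :: 'p::prime_card padic_int) n mod int CARD('p) ^ n = Rep_padic_int x n"
  using Rep_padic_int[of x] by (simp add: mod_pos_pos_trivial)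

lemma Rep_padic_int_Suc_mod:
  "Rep_padic_int (x :: 'p::prime_card padic_int) (Suc n) mod int CARD('p) ^ n = Rep_padic_int x n"
  using Rep_padic_int[of x] by simp

text \<open>
  The completeness of \<open>\<int>\<^sub>p\<close>.
\<close>

lemma padic_int_of_compatible:
  assumes "\<And>n. int CARD('p) ^ n dvd f (Suc n) - f n"
  obtains y :: "'p::prime_card padic_int" where "\<And>n. Rep_padic_int y n = f n mod int CARD('p) ^ n"
proof
  have "f (Suc n) mod int CARD('p) ^ n = f n mod int CARD('p) ^ n" for n
    using assms by (simp add: mod_eq_dvd_iff)
  then show "Rep_padic_int (Abs_padic_int (\<lambda>n. f n mod int CARD('p) ^ n) :: 'p padic_int) n
      = f n mod int CARD('p) ^ n" for n
    by (subst Abs_padic_int_inverse) (use padic_mod_closed[where 'p='p and z=f] in auto)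
qed

lemma Rep_padic_int_quadratic:
  fixes a b c y :: "'p::prime_card padic_int"
  shows "Rep_padic_int (a * y\<^sup>2 + b * y + c) n =
    (Rep_padic_int a n * (Rep_padic_int y n)\<^sup>2 + Rep_padic_int b n * Rep_padic_int y n
      + Rep_padic_int c n) mod int CARD('p) ^ n"
  unfolding power2_eq_square plus_padic_int.rep_eq times_padic_int.rep_eq by (simp add: mod_simps)

text \<open>
  Hensel's lemma for polynomials of degree at most two. The leading coefficient may vanish, so the linear case,
  which provides inverses of units, is included.
\<close>

lemma quadratic_hensel:
  fixes a b c x :: "'p::prime_card padic_int"
  assumes root: "padic_residue (a * x\<^sup>2 + b * x + c) = 0"
    and simple: "padic_residue (2 * a * x + b) \<noteq> 0"
  obtains y where "a * y\<^sup>2 + b * y + c = 0" and "padic_residue y = padic_residue x"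
proof -
  let ?p = "int CARD('p)"
  define A where "A = Rep_padic_int a"
  define B where "B = Rep_padic_int b"
  define C where "C = Rep_padic_int c"
  \<comment> \<open>The index is shifted by one, since the first approximation is a root modulo \<open>p\<close>, not modulo \<open>1\<close>.\<close>
  define good where "good n z \<longleftrightarrow> ?p ^ Suc n dvd A (Suc n) * z\<^sup>2 + B (Suc n) * z + C (Suc n)
    \<and> ?p dvd z - Rep_padic_int x 1" for n z
  have "\<exists>f. \<forall>n. good n (f n) \<and> ?p ^ Suc n dvd f (Suc n) - f n"
  proof (rule dependent_nat_choice, goal_cases)
    case 1
    have "?p dvd A 1 * (Rep_padic_int x 1)\<^sup>2 + B 1 * Rep_padic_int x 1 + C 1"
      using root Rep_padic_int_quadratic[of a x b c 1]
      by (simp add: padic_residue_def of_int_mod_ring_eq_0_iff A_def B_def C_def dvd_mod_iff)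
    then show ?case
      by (intro exI[of _ "Rep_padic_int x 1"]) (simp add: good_def)
  next
    case (2 z n)
    then have z: "good n z" .
    let ?n = "Suc n"
    have cong: "[A (Suc ?n) * z\<^sup>2 + B (Suc ?n) * z + C (Suc ?n) = A ?n * z\<^sup>2 + B ?n * z + C ?n] (mod ?p ^ ?n)"
      unfolding A_def B_def C_def
      by (intro cong_add cong_mult cong_refl)
        (simp_all only: cong_def Rep_padic_int_Suc_mod Rep_padic_int_mod)
    then have "?p ^ ?n dvd A (Suc ?n) * z\<^sup>2 + B (Suc ?n) * z + C (Suc ?n)"
      using z cong_dvd_iff good_def by blast
    moreover have "\<not> ?p dvd 2 * A (Suc ?n) * z + B (Suc ?n)"
    proof -
      have "(of_int (Rep_padic_int u (Suc ?n)) :: 'p mod_ring) = padic_residue u" for u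
      proof -
        have "Rep_padic_int u (Suc ?n) mod ?p ^ 1 = Rep_padic_int u 1"
          using padic_compatible[of 1 "Suc ?n" "Rep_padic_int u", where 'p='p] Rep_padic_int[of u] by simp
        then show ?thesis
          unfolding padic_residue_def by (metis of_int_mod_card power_one_right)
      qed
      moreover have "padic_residue 2 = (2 :: 'p mod_ring)"
        by (metis one_add_one padic_residue.hom_add padic_residue.hom_one)
      moreover have "(of_int z :: 'p mod_ring) = padic_residue x"
        using z unfolding good_def padic_residue_def
        by (metis of_int_mod_ring_eq_0_iff eq_iff_diff_eq_0 of_int_diff)
      ultimately have "(of_int (2 * A (Suc ?n) * z + B (Suc ?n)) :: 'p mod_ring) = padic_residue (2 * a * x + b)"
        by (simp add: A_def B_def padic_residue.hom_add padic_residue.hom_mult)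
      with simple show ?thesis
        by (metis of_int_mod_ring_eq_0_iff)
    qed
    ultimately obtain t where t: "?p ^ Suc ?n dvd
        A (Suc ?n) * (z + ?p ^ ?n * t)\<^sup>2 + B (Suc ?n) * (z + ?p ^ ?n * t) + C (Suc ?n)"
      using quadratic_hensel_step[OF prime_card_int[where 'a='p], of ?n] by (metis One_nat_def Suc_le_mono zero_le)
    have "?p dvd (z - Rep_padic_int x 1) + ?p ^ ?n * t"
      using z by (auto simp: good_def)
    then have "good (Suc n) (z + ?p ^ ?n * t)"
      using t by (simp add: good_def algebra_simps)
    then show ?case
      by (intro exI[of _ "z + ?p ^ ?n * t"]) simp
  qed
  then obtain f where f: "\<And>n. good n (f n)" "\<And>n. ?p ^ Suc n dvd f (Suc n) - f n"
    by blast
  have "?p ^ n dvd f n - f (n - 1)" for n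
    using f(2)[of "n - 1"] by (cases n) auto
  then obtain y :: "'p padic_int" where y: "\<And>n. Rep_padic_int y n = f (n - 1) mod ?p ^ n"
    using padic_int_of_compatible[where 'p='p and f="\<lambda>n. f (n - 1)"] by auto
  have "Rep_padic_int (a * y\<^sup>2 + b * y + c) n = 0" for n
  proof (cases n)
    case 0
    then show ?thesis by (simp add: Rep_padic_int_quadratic)
  next
    case (Suc m)
    then have "[Rep_padic_int y n = f m] (mod ?p ^ n)"
      by (simp add: y cong_def del: power_Suc)
    then have "[A n * (Rep_padic_int y n)\<^sup>2 + B n * Rep_padic_int y n + C n
      = A n * (f m)\<^sup>2 + B n * f m + C n] (mod ?p ^ n)"
      by (intro cong_add cong_mult cong_pow cong_refl)
    moreover have "[A n * (f m)\<^sup>2 + B n * f m + C n = 0] (mod ?p ^ n)"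
      using f(1)[of m] Suc by (simp add: good_def cong_0_iff del: power_Suc)
    ultimately have "(A n * (Rep_padic_int y n)\<^sup>2 + B n * Rep_padic_int y n + C n) mod ?p ^ n = 0"
      by (metis cong_def cong_trans mod_0)
    then show ?thesis
      by (simp add: Rep_padic_int_quadratic A_def B_def C_def)
  qed
  then have "a * y\<^sup>2 + b * y + c = 0"
    by (simp add: fun_eq_iff zero_padic_int.rep_eq flip: Rep_padic_int_inject)
  moreover have "padic_residue y = padic_residue x"
    using f(1)[of 0] y[of 1] unfolding good_def padic_residue_def
    by (metis of_int_mod_ring_eq_0_iff eq_iff_diff_eq_0 of_int_diff of_int_mod_card diff_self_eq_0 power_one_right)
  ultimately show thesis ..
qed

lemma padic_int_unit_iff: "x dvd 1 \<longleftrightarrow> padic_residue (x :: 'p::prime_card padic_int) \<noteq> 0"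
proof
  assume "x dvd 1"
  then obtain y where "1 = x * y" ..
  then have "padic_residue x * padic_residue y = 1"
    by (metis padic_residue.hom_mult padic_residue.hom_one)
  then show "padic_residue x \<noteq> 0"
    by auto
next
  assume x: "padic_residue x \<noteq> 0"
  obtain z where "padic_residue z = 1 / padic_residue x"
    using padic_residue_surj by blast
  then have "padic_residue (0 * z\<^sup>2 + x * z + - 1) = 0"
    using x by (simp add: padic_residue.hom_add padic_residue.hom_mult padic_residue.hom_minus)
  moreover have "padic_residue (2 * 0 * z + x) \<noteq> 0"
    using x by simp
  ultimately obtain y where "0 * y\<^sup>2 + x * y + - 1 = 0"
    by (rule quadratic_hensel)
  then show "x dvd 1"
    by (intro dvdI[of _ _ y]) simp
qed

text \<open>
  The values \<open>ax\<^sup>2\<close> and \<open>c - by\<^sup>2\<close> each fill more than half of the field, since squaring is at most two-to-one and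
  \<open>0\<close> has a single root. Hence they meet.
\<close>

lemma finite_field_binary_form_universal:
  fixes a b c :: "'a::{finite,field}"
  assumes "a \<noteq> 0" and "b \<noteq> 0"
  shows "\<exists>x y. a * x\<^sup>2 + b * y\<^sup>2 = c"
proof -
  define S where "S = range (\<lambda>x :: 'a. x\<^sup>2)"
  have fin: "finite S" and "0 \<in> S"
    using rangeI[of "\<lambda>x :: 'a. x\<^sup>2" 0] by (simp_all add: S_def)
  have fibre: "card {x :: 'a. x\<^sup>2 = s} \<le> 2" for s
  proof (cases "\<exists>x :: 'a. x\<^sup>2 = s")
    case True
    then obtain x :: 'a where "x\<^sup>2 = s" ..
    then have "{x. x\<^sup>2 = s} \<subseteq> {x, - x}"
      by (auto simp: power2_eq_iff)
    then have "card {x. x\<^sup>2 = s} \<le> card {x, - x}"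
      by (intro card_mono) auto
    also have "\<dots> \<le> 2"
      by (simp add: card_insert_if)
    finally show ?thesis .
  qed simp
  have "CARD('a) = (\<Sum>s\<in>S. card {x. x\<^sup>2 = s})"
  proof -
    have "CARD('a) = card (\<Union>s\<in>S. {x :: 'a. x\<^sup>2 = s})"
      by (rule arg_cong[of _ _ card]) (auto simp: S_def)
    also have "\<dots> = (\<Sum>s\<in>S. card {x. x\<^sup>2 = s})"
      by (rule card_UN_disjoint) (auto simp: fin)
    finally show ?thesis .
  qed
  also have "\<dots> = card {x :: 'a. x\<^sup>2 = 0} + (\<Sum>s\<in>S - {0}. card {x. x\<^sup>2 = s})"
    using fin \<open>0 \<in> S\<close> by (rule sum.remove)
  also have "\<dots> \<le> 1 + 2 * card (S - {0})"
    using sum_bounded_above[of "S - {0}" "\<lambda>s. card {x. x\<^sup>2 = s}" 2] fibre by simp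
  finally have S: "CARD('a) < 2 * card S"
    using fin \<open>0 \<in> S\<close> card_Suc_Diff1[of S 0] by simp
  have "(\<lambda>s. a * s) ` S \<inter> (\<lambda>s. c - b * s) ` S \<noteq> {}"
  proof
    assume "(\<lambda>s. a * s) ` S \<inter> (\<lambda>s. c - b * s) ` S = {}"
    then have "card ((\<lambda>s. a * s) ` S \<union> (\<lambda>s. c - b * s) ` S)
        = card ((\<lambda>s. a * s) ` S) + card ((\<lambda>s. c - b * s) ` S)"
      using fin by (intro card_Un_disjoint) auto
    also have "\<dots> = 2 * card S"
      using assms by (simp add: card_image inj_on_def)
    finally show False
      using S card_mono[of UNIV "(\<lambda>s. a * s) ` S \<union> (\<lambda>s. c - b * s) ` S"] by simp
  qed
  then obtain x y where "a * x\<^sup>2 = c - b * y\<^sup>2"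
    unfolding S_def by auto
  then show ?thesis
    by (metis diff_add_cancel)
qed

lemma padic_residue_two: "padic_residue 2 = 2"
  by (metis one_add_one padic_residue.hom_add padic_residue.hom_one)

lemma two_neq_0_mod_ring:
  assumes "odd CARD('p::prime_card)"
  shows "(2 :: 'p mod_ring) \<noteq> 0"
proof
  assume "(2 :: 'p mod_ring) = 0"
  then have "(of_int 2 :: 'p mod_ring) = 0"
    by simp
  then have "int CARD('p) dvd 2"
    by (simp only: of_int_mod_ring_eq_0_iff)
  then have "CARD('p) dvd 2"
    by presburger
  with assms have "CARD('p) = 1"
    by (metis dvd_refl prime_nat_iff two_is_prime_nat)
  then show False
    using prime_card[where 'a='p] by simp
qed

lemma padic_int_square_lift:
  fixes u :: "'p::prime_card padic_int"
  assumes "odd CARD('p)" and "padic_residue u = y\<^sup>2" and "y \<noteq> 0"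
  obtains v where "v\<^sup>2 = u" "padic_residue v = y"
proof -
  obtain z where z: "padic_residue z = y"
    using padic_residue_surj by blast
  have "padic_residue (1 * z\<^sup>2 + 0 * z + - u) = 0"
    using z assms by (simp add: padic_residue.hom_add padic_residue.hom_mult padic_residue.hom_minus power2_eq_square)
  moreover have "padic_residue (2 * 1 * z + 0) \<noteq> 0"
    using z assms two_neq_0_mod_ring[where 'p='p] by (simp add: padic_residue.hom_mult padic_residue_two)
  ultimately obtain v where "1 * v\<^sup>2 + 0 * v + - u = 0" "padic_residue v = padic_residue z"
    by (rule quadratic_hensel)
  then show thesis
    using that z by simp
qed

text \<open>
  A solution modulo \<open>p\<close> has a nonzero coordinate; the other one is lifted arbitrarily, and Hensel's lemma solves
  for the nonzero one.
\<close>

lemma padic_int_binary_form_one: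
  fixes a b :: "'p::prime_card padic_int"
  assumes "odd CARD('p)" and "a dvd 1" and "b dvd 1"
  shows "\<exists>x y. a * x\<^sup>2 + b * y\<^sup>2 = 1"
proof -
  have lift: "\<exists>x. a * x\<^sup>2 + b * y\<^sup>2 = 1"
    if "padic_residue a * \<xi>\<^sup>2 + padic_residue b * (padic_residue y)\<^sup>2 = 1" "\<xi> \<noteq> 0" "a dvd 1"
    for a b y :: "'p padic_int" and \<xi>
  proof -
    obtain z where z: "padic_residue z = \<xi>"
      using padic_residue_surj by blast
    have "padic_residue (a * z\<^sup>2 + 0 * z + (b * y\<^sup>2 - 1)) = 0"
      using that z by (simp add: padic_residue.hom_add padic_residue.hom_mult padic_residue.hom_minus power2_eq_square add_diff_eq)
    moreover have "padic_residue (2 * a * z + 0) \<noteq> 0"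
      using that z two_neq_0_mod_ring[where 'p='p] assms(1)
      by (simp add: padic_residue.hom_mult padic_residue_two padic_int_unit_iff)
    ultimately obtain x where "a * x\<^sup>2 + 0 * x + (b * y\<^sup>2 - 1) = 0"
      by (rule quadratic_hensel)
    then show ?thesis
      by (auto simp: algebra_simps)
  qed
  obtain \<xi> \<eta> where form: "padic_residue a * \<xi>\<^sup>2 + padic_residue b * \<eta>\<^sup>2 = 1"
    using finite_field_binary_form_universal[of "padic_residue a" "padic_residue b" 1] assms(2,3)
    by (auto simp: padic_int_unit_iff)
  obtain x y where xy: "padic_residue x = \<xi>" "padic_residue y = \<eta>"
    using padic_residue_surj by metis
  show ?thesis
  proof (cases "\<xi> = 0")
    case False
    then show ?thesis
      using lift[of a \<xi> b y] form xy assms(2) by auto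
  next
    case True
    then have "\<eta> \<noteq> 0"
      using form by auto
    then show ?thesis
      using lift[of b \<eta> a x] form xy assms(3) by (auto simp: add.commute)
  qed
qed

lemma universal_local_ring_padic_int:
  assumes "odd CARD('p::prime_card)"
  shows "universal_local_ring TYPE('p padic_int)"
proof
  fix x y a b :: "'p padic_int"
  show "x dvd 1 \<or> y dvd 1" if "x + y dvd 1"
    using that by (auto simp: padic_int_unit_iff padic_residue.hom_add)
  show "(2 :: 'p padic_int) dvd 1"
    using two_neq_0_mod_ring[OF assms] by (simp add: padic_int_unit_iff padic_residue_two)
  show "\<exists>x y. a * x\<^sup>2 + b * y\<^sup>2 = 1" if "a dvd 1" "b dvd 1"
    using padic_int_binary_form_one[OF assms that] .
qed

section \<open>Matrices over the quadratic extension\<close>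

lemma transpose_smult_mat: "(c \<cdot>\<^sub>m A)\<^sup>T = c \<cdot>\<^sub>m A\<^sup>T"
  by (rule eq_matI) auto

lemma smult_smult_mat: "a \<cdot>\<^sub>m (b \<cdot>\<^sub>m A) = (a * b) \<cdot>\<^sub>m (A :: 'a::semigroup_mult mat)"
  by (rule eq_matI) (auto simp: mult.assoc)

lemma one_smult_mat: "1 \<cdot>\<^sub>m A = (A :: 'a::monoid_mult mat)"
  by (rule eq_matI) auto

lemma add_left_commute_mat:
  "A \<in> carrier_mat m n \<Longrightarrow> B \<in> carrier_mat m n \<Longrightarrow> C \<in> carrier_mat m n \<Longrightarrow>
    A + (B + C) = B + (A + C :: 'a::ab_semigroup_add mat)"
  by (rule eq_matI) (auto simp: add.left_commute)

text \<open>
  Calculations with \<open>h + k\<surd>d\<close>, where \<open>d = -\<delta>\<close>, are carried out on the components \<open>h\<close> and \<open>k\<close>. The simplification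
  rules \<open>square_mat_simps\<close> bring every expression in square matrices into the form of an ordered sum of
  multiples of products, in which adjacent factors \<open>E\<close> cancel.
\<close>

locale sign_form =
  fixes n :: nat and E :: "'a::comm_ring_1 mat" and \<delta> :: 'a
  assumes E_carrier: "E \<in> carrier_mat n n"
    and E_sym: "E\<^sup>T = E"
    and E_invol: "E * E = 1\<^sub>m n"
begin

lemma E_E_mult: "X \<in> carrier_mat n n \<Longrightarrow> E * (E * X) = X"
  using E_carrier E_invol by (simp flip: assoc_mult_mat[of _ n n _ n _ n])

lemmas square_mat_simps =
  assoc_mult_mat[of _ n n _ n _ n] mult_add_distrib_mat[of _ n n _ n] add_mult_distrib_mat[of _ n n _ _ n]
  mult_smult_distrib[of _ n n _ n] mult_smult_assoc_mat[of _ n n _ n]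
  transpose_mult[of _ n n _ n] transpose_add[of _ n n] transpose_smult_mat
  mult_carrier_mat[of _ n n _ n] smult_carrier_mat[of _ n n] add_carrier_mat[of _ n n]
  left_mult_one_mat[of _ n n] right_mult_one_mat[of _ n n]
  E_carrier E_sym E_invol E_E_mult smult_smult_mat one_smult_mat add_smult_distrib_left_mat[of _ n n]
  assoc_add_mat[of _ n n] comm_add_mat[of _ n n] add_left_commute_mat[of _ n n]

text \<open>
  For symmetric \<open>S\<close> this is \<open>T(S) = M(S)EM(S)\<^sup>*\<close>, where \<open>M(S) = 1 + SE\<surd>d\<close>.
\<close>

definition form :: "'a mat \<Rightarrow> 'a mat" where
  "form S = E + \<delta> \<cdot>\<^sub>m (S * E * S)"

text \<open>
  The two components of \<open>(h + k\<surd>d)E(h + k\<surd>d)\<^sup>* = cE\<close>.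
\<close>

definition similitude :: "'a \<Rightarrow> 'a mat \<Rightarrow> 'a mat \<Rightarrow> bool" where
  "similitude c h k \<longleftrightarrow> h * E * h\<^sup>T + \<delta> \<cdot>\<^sub>m (k * E * k\<^sup>T) = c \<cdot>\<^sub>m E \<and> k * E * h\<^sup>T = h * E * k\<^sup>T"

lemma form_carrier [simp]: "S \<in> carrier_mat n n \<Longrightarrow> form S \<in> carrier_mat n n"
  using E_carrier by (simp add: form_def)

lemma form_sym: "S \<in> carrier_mat n n \<Longrightarrow> S\<^sup>T = S \<Longrightarrow> (form S)\<^sup>T = form S"
  by (simp add: form_def square_mat_simps)

text \<open>
  Here \<open>N + PE\<surd>d = M(S)(h + k\<surd>d)\<close>, and both sides evaluate \<open>M(S)\<gg>E\<gg>\<^sup>*M(S)\<^sup>*\<close> for \<open>\<gg> = h + k\<surd>d\<close>.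
\<close>

lemma form_transport:
  assumes carrier: "h \<in> carrier_mat n n" "k \<in> carrier_mat n n" "S \<in> carrier_mat n n"
    and "S\<^sup>T = S" and sim: "similitude c h k"
    and N: "N = h + (- \<delta>) \<cdot>\<^sub>m (S * E * k)" and P: "P = k * E + S * E * h * E"
  shows "N * E * N\<^sup>T + \<delta> \<cdot>\<^sub>m (P * E * P\<^sup>T) = c \<cdot>\<^sub>m form S"
proof -
  define X Y Z where "X = h * E * h\<^sup>T" and "Y = k * E * k\<^sup>T" and "Z = h * E * k\<^sup>T"
  have XYZ: "X \<in> carrier_mat n n" "Y \<in> carrier_mat n n" "Z \<in> carrier_mat n n"
    using carrier by (auto simp: X_def Y_def Z_def square_mat_simps)
  have XY: "X + \<delta> \<cdot>\<^sub>m Y = c \<cdot>\<^sub>m E" and Z: "k * E * h\<^sup>T = Z"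
    using sim by (auto simp: similitude_def X_def Y_def Z_def)
  have "N * E * N\<^sup>T = (X + (- \<delta>) \<cdot>\<^sub>m (Z * E * S)) + ((- \<delta>) \<cdot>\<^sub>m (S * E * (k * E * h\<^sup>T)) + (\<delta> * \<delta>) \<cdot>\<^sub>m (S * E * Y * E * S))"
    unfolding N X_def Y_def Z_def using carrier \<open>S\<^sup>T = S\<close>
    by (simp add: square_mat_simps)
  moreover have "P * E * P\<^sup>T = (Y + (k * E * h\<^sup>T) * E * S) + (S * E * Z + S * E * X * E * S)"
    unfolding P X_def Y_def Z_def using carrier \<open>S\<^sup>T = S\<close>
    by (simp add: square_mat_simps)
  moreover have "S * E * (X + \<delta> \<cdot>\<^sub>m Y) * E * S = S * E * X * E * S + \<delta> \<cdot>\<^sub>m (S * E * Y * E * S)"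
    using carrier XYZ by (simp add: square_mat_simps)
  moreover have "S * E * (X + \<delta> \<cdot>\<^sub>m Y) * E * S = c \<cdot>\<^sub>m (S * E * S)"
    unfolding XY using carrier by (simp add: square_mat_simps)
  moreover have "(X + (- \<delta>) \<cdot>\<^sub>m U) + ((- \<delta>) \<cdot>\<^sub>m V + (\<delta> * \<delta>) \<cdot>\<^sub>m W) + \<delta> \<cdot>\<^sub>m ((Y + U) + (V + W'))
      = (X + \<delta> \<cdot>\<^sub>m Y) + \<delta> \<cdot>\<^sub>m (W' + \<delta> \<cdot>\<^sub>m W)"
    if "U \<in> carrier_mat n n" "V \<in> carrier_mat n n" "W \<in> carrier_mat n n" "W' \<in> carrier_mat n n" for U V W W'
    using that XYZ by (intro eq_matI) (auto simp: algebra_simps)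
  note this[of "Z * E * S" "S * E * Z" "S * E * Y * E * S" "S * E * X * E * S"]
  ultimately have "N * E * N\<^sup>T + \<delta> \<cdot>\<^sub>m (P * E * P\<^sup>T) = c \<cdot>\<^sub>m E + \<delta> \<cdot>\<^sub>m (c \<cdot>\<^sub>m (S * E * S))"
    using XYZ carrier by (simp add: Z XY mult_carrier_mat[of _ n n _ n] E_carrier)
  also have "\<dots> = c \<cdot>\<^sub>m form S"
    unfolding form_def using carrier E_carrier by (intro eq_matI) (auto simp: algebra_simps)
  finally show ?thesis .
qed

text \<open>
  The matrix \<open>M(S)\<close> has the right inverse \<open>EM(S)\<^sup>*U = (E - S\<surd>d)U\<close>. The last two identities express that
  \<open>(E - S\<surd>d)U(E + S\<surd>d) = E\<close>; they follow from \<open>T(S)ES = SET(S)\<close>.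
\<close>

lemma form_inverse_intertwines:
  assumes carrier: "S \<in> carrier_mat n n" "U \<in> carrier_mat n n" and "S\<^sup>T = S"
    and inv: "form S * U = 1\<^sub>m n" "U * form S = 1\<^sub>m n"
  shows "U\<^sup>T = U" and "S * U = E * U * S * E" and "E * U * E + \<delta> \<cdot>\<^sub>m (S * U * S) = E"
proof -
  have F: "form S \<in> carrier_mat n n"
    using carrier by simp
  have "U\<^sup>T * form S = 1\<^sub>m n"
    using arg_cong[OF inv(1), of transpose_mat] carrier F \<open>S\<^sup>T = S\<close>
    by (simp add: transpose_mult[of _ n n _ n] form_sym)
  then have "U\<^sup>T * form S * U = U"
    using carrier by simp
  then show "U\<^sup>T = U"
    using carrier F inv(1) by (simp add: assoc_mult_mat[of _ n n _ n _ n])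
  have comm: "form S * E * S = S * E * form S"
    using carrier unfolding form_def by (simp add: square_mat_simps)
  have "E * U * S * E = E * U * (S * E * form S) * U"
    using carrier F inv(1)
    by (simp add: assoc_mult_mat[of _ n n _ n _ n] mult_carrier_mat[of _ n n _ n] right_mult_one_mat[of _ n n] E_carrier)
  also have "\<dots> = E * (U * form S) * E * S * U"
    unfolding comm[symmetric]
    using carrier F E_carrier by (simp add: assoc_mult_mat[of _ n n _ n _ n] mult_carrier_mat[of _ n n _ n])
  also have "\<dots> = S * U"
    unfolding inv(2) using carrier by (simp add: square_mat_simps)
  finally show SU: "S * U = E * U * S * E" ..
  have "E * U * E + \<delta> \<cdot>\<^sub>m (S * U * S) = E * U * form S"
    unfolding SU form_def using carrier by (simp add: square_mat_simps)
  also have "\<dots> = E"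
    using carrier F E_carrier inv(2) by (simp add: assoc_mult_mat[of _ n n _ n _ n])
  finally show "E * U * E + \<delta> \<cdot>\<^sub>m (S * U * S) = E" .
qed

text \<open>
  The pair \<open>(h, k)\<close> consists of the components of \<open>(E - S\<surd>d)UNM(S')\<close>, that is, of
  \<open>M(S)\<^sup>-\<^sup>1NM(S')\<close>. The last two conclusions are the components of \<open>M(S)(h + k\<surd>d) = NM(S')\<close>.
\<close>

lemma similitude_of_congruence:
  assumes carrier: "S \<in> carrier_mat n n" "S' \<in> carrier_mat n n" "U \<in> carrier_mat n n" "N \<in> carrier_mat n n"
    and sym: "S\<^sup>T = S" "S'\<^sup>T = S'"
    and inv: "form S * U = 1\<^sub>m n" "U * form S = 1\<^sub>m n"
    and congr: "N * form S' * N\<^sup>T = c \<cdot>\<^sub>m form S"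
    and h: "h = E * U * N + \<delta> \<cdot>\<^sub>m (S * U * N * S' * E)"
    and k: "k = E * U * N * S' * E + (- 1) \<cdot>\<^sub>m (S * U * N)"
  shows "similitude c h k"
    and "h + (- \<delta>) \<cdot>\<^sub>m (S * E * k) = N"
    and "k * E + S * E * h * E = N * S'"
proof -
  note U = form_inverse_intertwines[OF carrier(1,3) sym(1) inv]
  define M where "M = U * N"
  have M: "M \<in> carrier_mat n n"
    using carrier by (simp add: M_def mult_carrier_mat[of _ n n _ n])
  have h: "h = E * M + \<delta> \<cdot>\<^sub>m (S * M * S' * E)" and k: "k = E * M * S' * E + (- 1) \<cdot>\<^sub>m (S * M)"
    using carrier by (simp_all add: h k M_def square_mat_simps)
  have hk: "h \<in> carrier_mat n n" "k \<in> carrier_mat n n"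
    unfolding h k using carrier M by (simp_all add: square_mat_simps)
  define Q where "Q = M * E * M\<^sup>T + \<delta> \<cdot>\<^sub>m (M * S' * E * S' * M\<^sup>T)"
  have Q: "Q = c \<cdot>\<^sub>m U"
  proof -
    have "Q = U * (N * form S' * N\<^sup>T) * U"
      unfolding Q_def M_def form_def using carrier sym U(1) by (simp add: square_mat_simps)
    also have "\<dots> = c \<cdot>\<^sub>m (U * form S * U)"
      unfolding congr using carrier by (simp add: square_mat_simps)
    finally show ?thesis
      using inv carrier by simp
  qed
  have "h * E * h\<^sup>T + \<delta> \<cdot>\<^sub>m (k * E * k\<^sup>T) = E * Q * E + \<delta> \<cdot>\<^sub>m (S * Q * S)"
  proof -
    define A B C D1 D2 D3 where "A = E * M * E * M\<^sup>T * E" and "B = E * M * S' * M\<^sup>T * S"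
      and "C = S * M * S' * M\<^sup>T * E" and "D1 = S * M * S' * E * S' * M\<^sup>T * S"
      and "D2 = E * M * S' * E * S' * M\<^sup>T * E" and "D3 = S * M * E * M\<^sup>T * S"
    have 1: "h * E * h\<^sup>T = A + \<delta> \<cdot>\<^sub>m B + \<delta> \<cdot>\<^sub>m C + (\<delta> * \<delta>) \<cdot>\<^sub>m D1"
      unfolding h A_def B_def C_def D1_def using carrier M sym by (simp add: square_mat_simps)
    have 2: "k * E * k\<^sup>T = D2 + (- 1) \<cdot>\<^sub>m B + (- 1) \<cdot>\<^sub>m C + D3"
      unfolding k A_def B_def C_def D2_def D3_def using carrier M sym by (simp add: square_mat_simps)
    have 3: "E * Q * E = A + \<delta> \<cdot>\<^sub>m D2"
      unfolding Q_def A_def D2_def using carrier M sym by (simp add: square_mat_simps)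
    have 4: "S * Q * S = D3 + \<delta> \<cdot>\<^sub>m D1"
      unfolding Q_def D1_def D3_def using carrier M sym by (simp add: square_mat_simps)
    have "A \<in> carrier_mat n n" "B \<in> carrier_mat n n" "C \<in> carrier_mat n n"
      "D1 \<in> carrier_mat n n" "D2 \<in> carrier_mat n n" "D3 \<in> carrier_mat n n"
      unfolding A_def B_def C_def D1_def D2_def D3_def using carrier M by (simp_all add: square_mat_simps)
    then show ?thesis
      unfolding 1 2 3 4 by (intro eq_matI) (auto simp: algebra_simps simp del: index_mult_mat(1))
  qed
  also have "\<dots> = c \<cdot>\<^sub>m (E * U * E + \<delta> \<cdot>\<^sub>m (S * U * S))"
    unfolding Q using carrier by (simp add: square_mat_simps mult.commute)
  finally have "h * E * h\<^sup>T + \<delta> \<cdot>\<^sub>m (k * E * k\<^sup>T) = c \<cdot>\<^sub>m E"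
    unfolding U(3) .
  moreover have "k * E * h\<^sup>T = h * E * k\<^sup>T"
  proof -
    define A B where "A = E * M * S' * M\<^sup>T * E" and "B = S * M * S' * M\<^sup>T * S"
    have 1: "k * E * h\<^sup>T = (A + (- \<delta>) \<cdot>\<^sub>m B) + (E * M * (\<delta> \<cdot>\<^sub>m (S' * E * S')) * M\<^sup>T * S + (- 1) \<cdot>\<^sub>m (S * M * E * M\<^sup>T * E))"
      unfolding k h A_def B_def using carrier M sym by (simp add: square_mat_simps)
    have 2: "h * E * k\<^sup>T = (A + (- \<delta>) \<cdot>\<^sub>m B) + (S * M * (\<delta> \<cdot>\<^sub>m (S' * E * S')) * M\<^sup>T * E + (- 1) \<cdot>\<^sub>m (E * M * E * M\<^sup>T * S))"
      unfolding k h A_def B_def using carrier M sym by (simp add: square_mat_simps)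
    have "E * Q * S = S * Q * E"
      unfolding Q using carrier U(2) by (simp add: square_mat_simps)
    moreover have "E * Q * S = E * M * E * M\<^sup>T * S + E * M * (\<delta> \<cdot>\<^sub>m (S' * E * S')) * M\<^sup>T * S"
      unfolding Q_def using carrier M by (simp add: square_mat_simps)
    moreover have "S * Q * E = S * M * E * M\<^sup>T * E + S * M * (\<delta> \<cdot>\<^sub>m (S' * E * S')) * M\<^sup>T * E"
      unfolding Q_def using carrier M by (simp add: square_mat_simps)
    ultimately have 3: "E * M * E * M\<^sup>T * S + E * M * (\<delta> \<cdot>\<^sub>m (S' * E * S')) * M\<^sup>T * S
        = S * M * E * M\<^sup>T * E + S * M * (\<delta> \<cdot>\<^sub>m (S' * E * S')) * M\<^sup>T * E"
      by simp
    have cancel: "Y + (- 1) \<cdot>\<^sub>m Z = Y' + (- 1) \<cdot>\<^sub>m Z'"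
      if "Z' + Y = Z + Y'" "Y \<in> carrier_mat n n" "Z \<in> carrier_mat n n" "Y' \<in> carrier_mat n n" "Z' \<in> carrier_mat n n"
      for Y Y' Z Z' :: "'a mat"
    proof (rule eq_matI)
      fix i j assume "i < dim_row (Y' + (- 1) \<cdot>\<^sub>m Z')" "j < dim_col (Y' + (- 1) \<cdot>\<^sub>m Z')"
      then show "(Y + (- 1) \<cdot>\<^sub>m Z) $$ (i, j) = (Y' + (- 1) \<cdot>\<^sub>m Z') $$ (i, j)"
        using arg_cong[OF that(1), of "\<lambda>A. A $$ (i, j)"] that(2-5) by (auto simp: algebra_simps)
    qed (use that in auto)
    show ?thesis
      unfolding 1 2 using carrier M
      by (intro arg_cong2[of _ _ _ _ "(+)"] refl cancel[OF 3])
        (simp_all add: mult_carrier_mat[of _ n n _ n] smult_carrier_mat[of _ n n] E_carrier)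
  qed
  ultimately show "similitude c h k"
    by (simp add: similitude_def)
  have SM: "E * M + \<delta> \<cdot>\<^sub>m (S * E * S * M) = N"
  proof -
    have "E * M + \<delta> \<cdot>\<^sub>m (S * E * S * M) = form S * U * N"
      unfolding form_def M_def using carrier by (simp add: square_mat_simps)
    then show ?thesis
      using inv carrier by simp
  qed
  show "h + (- \<delta>) \<cdot>\<^sub>m (S * E * k) = N"
  proof -
    have "h + (- \<delta>) \<cdot>\<^sub>m (S * E * k) = (E * M + \<delta> \<cdot>\<^sub>m (S * E * S * M)) + (\<delta> \<cdot>\<^sub>m (S * M * S' * E) + (- \<delta>) \<cdot>\<^sub>m (S * M * S' * E))"
      unfolding h k using carrier M by (simp add: square_mat_simps)
    also have "\<dots> = E * M + \<delta> \<cdot>\<^sub>m (S * E * S * M)"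
      using carrier M E_carrier by (intro eq_matI) (auto simp del: index_mult_mat(1))
    finally show ?thesis
      using SM by simp
  qed
  show "k * E + S * E * h * E = N * S'"
  proof -
    have "k * E + S * E * h * E = (E * M + \<delta> \<cdot>\<^sub>m (S * E * S * M)) * S' + (S * M * E + (- 1) \<cdot>\<^sub>m (S * M * E))"
      unfolding h k using carrier M by (simp add: square_mat_simps)
    also have "\<dots> = N * S'"
      unfolding SM using carrier M E_carrier by (intro eq_matI) (auto simp del: index_mult_mat(1))
    finally show ?thesis .
  qed
qed

end

lemma sign_mat_carrier: "sign_mat r s \<in> carrier_mat (r + s) (r + s)"
  by (simp add: sign_mat_def)

lemma sign_form_sign_mat: "sign_form (r + s) (sign_mat r s :: 'a::comm_ring_1 mat)"
proof
  show "(sign_mat r s)\<^sup>T = (sign_mat r s :: 'a mat)"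
    by (rule eq_matI) (auto simp: sign_mat_def mat_diag_def)
  have "sign_mat r s * sign_mat r s = (mat_diag (r + s) (\<lambda>_. 1) :: 'a mat)"
    unfolding sign_mat_def mat_diag_diag by (rule arg_cong[of _ _ "mat_diag (r + s)"]) auto
  then show "sign_mat r s * sign_mat r s = (1\<^sub>m (r + s) :: 'a mat)"
    by simp
qed (rule sign_mat_carrier)

lemma map_mat_sign_mat: "map_mat of_int (sign_mat r s) = (sign_mat r s :: 'a::comm_ring_1 mat)"
  by (rule eq_matI) (auto simp: sign_mat_def mat_diag_def)

lemma map_mat_Tmat:
  assumes "S \<in> carrier_mat (r + s) (r + s)"
  shows "map_mat of_int (Tmat r s \<Delta> S) =
    sign_form.form (sign_mat r s) (of_int \<Delta> :: 'a::comm_ring_1) (map_mat of_int S)"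
proof -
  have "map_mat (of_int :: int \<Rightarrow> 'a) (S * sign_mat r s * S) = map_mat of_int S * sign_mat r s * map_mat of_int S"
    using assms sign_mat_carrier[of r s, where 'a=int] sign_mat_carrier[of r s, where 'a='a]
    by (simp add: of_int_hom.mat_hom_mult[of _ "r + s" "r + s" _ "r + s"] mult_carrier_mat[of _ "r + s" "r + s" _ "r + s"] map_mat_sign_mat
        assoc_mult_mat[of _ "r + s" "r + s" _ "r + s" _ "r + s"])
  then have "map_mat (of_int :: int \<Rightarrow> 'a) (Tmat r s \<Delta> S) =
      map_mat of_int (sign_mat r s) + of_int \<Delta> \<cdot>\<^sub>m (map_mat of_int S * sign_mat r s * map_mat of_int S)"
    unfolding Tmat_def using assms sign_mat_carrier[of r s, where 'a=int]
    by (intro eq_matI) (auto simp del: index_mult_mat(1) simp flip: \<open>map_mat of_int (S * _ * S) = _\<close>)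
  then show ?thesis
    unfolding sign_form.form_def[OF sign_form_sign_mat] map_mat_sign_mat .
qed

section \<open>Symplectic similitudes and integrality\<close>

lemma symplectic_form_carrier [simp]: "symplectic_form n \<in> carrier_mat (2 * n) (2 * n)"
  by (simp add: symplectic_form_def mult_2)

lemma mult_symplectic_form:
  fixes A :: "'a::comm_ring_1 mat"
  assumes "A \<in> carrier_mat n n" "B \<in> carrier_mat n n" "C \<in> carrier_mat n n" "D \<in> carrier_mat n n"
  shows "four_block_mat A B C D * symplectic_form n = four_block_mat (- B) A (- D) C"
  unfolding symplectic_form_def
  by (subst mult_four_block_mat[of _ n n _ n _ n _ _ n _ n]) (use assms in auto)

lemma symplectic_congruence:
  fixes A :: "'a::comm_ring_1 mat"
  assumes "A \<in> carrier_mat n n" "B \<in> carrier_mat n n" "C \<in> carrier_mat n n" "D \<in> carrier_mat n n"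
  shows "four_block_mat A B C D * symplectic_form n * (four_block_mat A B C D)\<^sup>T =
    four_block_mat (A * B\<^sup>T - B * A\<^sup>T) (A * D\<^sup>T - B * C\<^sup>T) (C * B\<^sup>T - D * A\<^sup>T) (C * D\<^sup>T - D * C\<^sup>T)"
proof -
  have eq: "- Y + Z = Z - Y" if "Y \<in> carrier_mat n n" "Z \<in> carrier_mat n n" for Y Z :: "'a mat"
    using that by (intro eq_matI) auto
  have "four_block_mat A B C D * symplectic_form n * (four_block_mat A B C D)\<^sup>T =
    four_block_mat (- (B * A\<^sup>T) + A * B\<^sup>T) (- (B * C\<^sup>T) + A * D\<^sup>T)
      (- (D * A\<^sup>T) + C * B\<^sup>T) (- (D * C\<^sup>T) + C * D\<^sup>T)"
    unfolding mult_symplectic_form[OF assms] using assms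
    by (subst transpose_four_block_mat[of _ n n _ n _ n], simp_all)
      (subst mult_four_block_mat[of _ n n _ n _ n _ _ n _ n], auto)
  also have "\<dots> = four_block_mat (A * B\<^sup>T - B * A\<^sup>T) (A * D\<^sup>T - B * C\<^sup>T) (C * B\<^sup>T - D * A\<^sup>T) (C * D\<^sup>T - D * C\<^sup>T)"
    by (intro cong_four_block_mat eq) (use assms in auto)
  finally show ?thesis .
qed

lemma smult_symplectic_form:
  "c \<cdot>\<^sub>m symplectic_form n = four_block_mat (0\<^sub>m n n) (c \<cdot>\<^sub>m 1\<^sub>m n) (- (c \<cdot>\<^sub>m 1\<^sub>m n)) (0\<^sub>m n n)"
  unfolding symplectic_form_def by (rule eq_matI) auto

text \<open>
  The matrix \<open>\<sigma>(S)\<close> over an arbitrary ring, with \<open>q\<close> in the place of \<open>p\<close>.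
\<close>

definition sigma_matrix :: "nat \<Rightarrow> 'a::comm_ring_1 \<Rightarrow> 'a mat \<Rightarrow> 'a mat" where
  "sigma_matrix n q S = four_block_mat (1\<^sub>m n) S (0\<^sub>m n n) (q \<cdot>\<^sub>m 1\<^sub>m n)"

lemma sigma_matrix_carrier [simp]:
  "S \<in> carrier_mat n n \<Longrightarrow> sigma_matrix n q S \<in> carrier_mat (2 * n) (2 * n)"
  by (simp add: sigma_matrix_def mult_2)

lemma sigma_matrix_symplectic:
  assumes "S \<in> carrier_mat n n" "S\<^sup>T = S"
  shows "sigma_matrix n q S * symplectic_form n * (sigma_matrix n q S)\<^sup>T = q \<cdot>\<^sub>m symplectic_form n"
  unfolding sigma_matrix_def smult_symplectic_form using assms
  by (subst symplectic_congruence) (auto intro!: cong_four_block_mat eq_matI simp: transpose_smult_mat)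

lemma sigma_matrix_mult_left:
  assumes "A \<in> carrier_mat n n" "B \<in> carrier_mat n n" "C \<in> carrier_mat n n" "D \<in> carrier_mat n n"
    and "S \<in> carrier_mat n n"
  shows "sigma_matrix n q S * four_block_mat A B C D =
    four_block_mat (A + S * C) (B + S * D) (q \<cdot>\<^sub>m C) (q \<cdot>\<^sub>m D)"
  unfolding sigma_matrix_def using assms
  by (subst mult_four_block_mat[of _ n n _ n _ n _ _ n _ n])
    (auto simp: mult_smult_assoc_mat[of _ n n _ n])

lemma sigma_matrix_mult_right:
  assumes "A \<in> carrier_mat n n" "B \<in> carrier_mat n n" "C \<in> carrier_mat n n" "D \<in> carrier_mat n n"
    and "S \<in> carrier_mat n n"
  shows "four_block_mat A B C D * sigma_matrix n q S =
    four_block_mat A (A * S + q \<cdot>\<^sub>m B) C (C * S + q \<cdot>\<^sub>m D)"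
  unfolding sigma_matrix_def using assms
  by (subst mult_four_block_mat[of _ n n _ n _ n _ _ n _ n])
    (auto simp: mult_smult_distrib[of _ n n _ n])

context sign_form
begin

text \<open>
  The matrix \<open>\<alpha>(h + k\<surd>d)\<close> over an arbitrary ring.
\<close>

definition alpha_matrix :: "'a mat \<Rightarrow> 'a mat \<Rightarrow> 'a mat" where
  "alpha_matrix h k = four_block_mat h (k * E) ((- \<delta>) \<cdot>\<^sub>m (E * k)) (E * h * E)"

lemma alpha_matrix_carrier [simp]:
  "h \<in> carrier_mat n n \<Longrightarrow> k \<in> carrier_mat n n \<Longrightarrow> alpha_matrix h k \<in> carrier_mat (2 * n) (2 * n)"
  unfolding alpha_matrix_def mult_2 using E_carrier
  by (intro four_block_carrier_mat) (simp_all add: mult_carrier_mat[of _ n n _ n])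

lemma alpha_matrix_symplectic:
  assumes carrier: "h \<in> carrier_mat n n" "k \<in> carrier_mat n n" and sim: "similitude c h k"
  shows "alpha_matrix h k * symplectic_form n * (alpha_matrix h k)\<^sup>T = c \<cdot>\<^sub>m symplectic_form n"
proof -
  have u1: "h * E * h\<^sup>T + \<delta> \<cdot>\<^sub>m (k * E * k\<^sup>T) = c \<cdot>\<^sub>m E" and u2: "k * E * h\<^sup>T = h * E * k\<^sup>T"
    using sim by (auto simp: similitude_def)
  define X Y Z where "X = h * E * h\<^sup>T" and "Y = k * E * k\<^sup>T" and "Z = h * E * k\<^sup>T"
  have XYZ: "X \<in> carrier_mat n n" "Y \<in> carrier_mat n n" "Z \<in> carrier_mat n n"
    using carrier by (auto simp: X_def Y_def Z_def square_mat_simps)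
  have XE: "X * E + \<delta> \<cdot>\<^sub>m (Y * E) = c \<cdot>\<^sub>m 1\<^sub>m n" and EX: "E * X + \<delta> \<cdot>\<^sub>m (E * Y) = c \<cdot>\<^sub>m 1\<^sub>m n"
  proof -
    have "X * E + \<delta> \<cdot>\<^sub>m (Y * E) = (X + \<delta> \<cdot>\<^sub>m Y) * E" "E * X + \<delta> \<cdot>\<^sub>m (E * Y) = E * (X + \<delta> \<cdot>\<^sub>m Y)"
      using XYZ by (simp_all add: square_mat_simps)
    then show "X * E + \<delta> \<cdot>\<^sub>m (Y * E) = c \<cdot>\<^sub>m 1\<^sub>m n" "E * X + \<delta> \<cdot>\<^sub>m (E * Y) = c \<cdot>\<^sub>m 1\<^sub>m n"
      using u1 by (simp_all add: X_def Y_def square_mat_simps)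
  qed
  let ?B = "k * E" and ?C = "(- \<delta>) \<cdot>\<^sub>m (E * k)" and ?D = "E * h * E"
  have BCD: "?B \<in> carrier_mat n n" "?C \<in> carrier_mat n n" "?D \<in> carrier_mat n n"
    using carrier by (simp_all add: square_mat_simps)
  have 1: "h * ?B\<^sup>T = Z" "?B * h\<^sup>T = Z"
    using carrier u2 by (simp_all add: Z_def square_mat_simps)
  have 2: "h * ?D\<^sup>T = X * E" "?B * ?C\<^sup>T = (- \<delta>) \<cdot>\<^sub>m (Y * E)"
    using carrier by (simp_all add: X_def Y_def square_mat_simps)
  have 3: "?C * ?B\<^sup>T = (- \<delta>) \<cdot>\<^sub>m (E * Y)" "?D * h\<^sup>T = E * X"
    using carrier by (simp_all add: X_def Y_def square_mat_simps)
  have 4: "?C * ?D\<^sup>T = (- \<delta>) \<cdot>\<^sub>m (E * (k * E * h\<^sup>T) * E)" "?D * ?C\<^sup>T = (- \<delta>) \<cdot>\<^sub>m (E * Z * E)"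
    using carrier by (simp_all add: Z_def square_mat_simps)
  have "X * E - (- \<delta>) \<cdot>\<^sub>m (Y * E) = X * E + \<delta> \<cdot>\<^sub>m (Y * E)"
    "(- \<delta>) \<cdot>\<^sub>m (E * Y) - E * X = - (E * X + \<delta> \<cdot>\<^sub>m (E * Y))"
    using XYZ E_carrier by (auto intro!: eq_matI simp del: index_mult_mat(1))
  then show ?thesis
    unfolding alpha_matrix_def smult_symplectic_form symplectic_congruence[OF carrier(1) BCD] 1 2 3 4 u2 Z_def[symmetric]
    using XYZ E_carrier XE EX by (auto intro!: cong_four_block_mat)
qed

text \<open>
  By the hypotheses the upper rows of the product are \<open>N(1, S')\<close>; the lower rows are divisible by \<open>q\<close>.
\<close>

lemma sigma_alpha_matrix_factors:
  assumes carrier: "h \<in> carrier_mat n n" "k \<in> carrier_mat n n" "S \<in> carrier_mat n n" "S' \<in> carrier_mat n n"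
    "N \<in> carrier_mat n n"
    and N: "h + (- \<delta>) \<cdot>\<^sub>m (S * E * k) = N" and P: "k * E + S * E * h * E = N * S'"
  obtains X where "X \<in> carrier_mat (2 * n) (2 * n)"
    and "sigma_matrix n q S * alpha_matrix h k = X * sigma_matrix n q S'"
proof -
  let ?C = "(- \<delta>) \<cdot>\<^sub>m (E * k)" and ?D = "E * h * E"
  define X where "X = four_block_mat N (0\<^sub>m n n) (q \<cdot>\<^sub>m ?C) (?D + (- 1) \<cdot>\<^sub>m (?C * S'))"
  have CD: "?C \<in> carrier_mat n n" "?D \<in> carrier_mat n n"
    using carrier by (simp_all add: square_mat_simps)
  have "q \<cdot>\<^sub>m ?C * S' + q \<cdot>\<^sub>m (?D + (- 1) \<cdot>\<^sub>m (?C * S')) = q \<cdot>\<^sub>m ?D"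
  proof -
    have "q \<cdot>\<^sub>m Y + q \<cdot>\<^sub>m (W + (- 1) \<cdot>\<^sub>m Y) = q \<cdot>\<^sub>m W"
      if "W \<in> carrier_mat n n" "Y \<in> carrier_mat n n" for W Y
      using that by (intro eq_matI) (auto simp: algebra_simps)
    then show ?thesis
      using CD carrier by (simp add: mult_smult_assoc_mat[of ?C n n S' n] mult_carrier_mat[of _ n n _ n])
  qed
  then have "X * sigma_matrix n q S' = four_block_mat N (N * S') (q \<cdot>\<^sub>m ?C) (q \<cdot>\<^sub>m ?D)"
    unfolding X_def using carrier CD
    by (subst sigma_matrix_mult_right)
      (auto simp: mult_carrier_mat[of _ n n _ n] intro!: cong_four_block_mat)
  also have "\<dots> = sigma_matrix n q S * alpha_matrix h k"
  proof -
    have "h + S * ?C = N"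
      unfolding N[symmetric] using carrier by (simp add: square_mat_simps)
    moreover have "k * E + S * ?D = N * S'"
      unfolding P[symmetric] using carrier by (simp add: square_mat_simps)
    ultimately show ?thesis
      unfolding alpha_matrix_def using carrier CD E_carrier
      by (subst sigma_matrix_mult_left) (simp_all add: mult_carrier_mat[of _ n n _ n])
  qed
  finally show thesis
    using that[of X] carrier CD
    by (simp add: X_def mult_2 mult_carrier_mat[of _ n n _ n])
qed

end

lemma smult_cancel_mat:
  fixes q :: "'a::idom"
  assumes "A \<in> carrier_mat m n" "B \<in> carrier_mat m n" and "q \<noteq> 0" and "q \<cdot>\<^sub>m A = q \<cdot>\<^sub>m B"
  shows "A = B"
proof (rule eq_matI)
  fix i j assume "i < dim_row B" "j < dim_col B"
  then show "A $$ (i, j) = B $$ (i, j)"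
    using arg_cong[OF assms(4), of "\<lambda>M. M $$ (i, j)"] assms(1-3) by simp
qed (use assms in auto)

text \<open>
  The multipliers of both \<open>\<sigma>\<close> matrices are \<open>q\<close>, so \<open>X\<close> is symplectic with the multiplier of \<open>A\<close>, after
  cancelling \<open>q\<close>.
\<close>

lemma GSp_factor:
  fixes q :: "'a::idom"
  assumes carrier: "A \<in> carrier_mat (2 * n) (2 * n)" "X \<in> carrier_mat (2 * n) (2 * n)"
    "S \<in> carrier_mat n n" "S' \<in> carrier_mat n n"
    and sym: "S\<^sup>T = S" "S'\<^sup>T = S'" and "q \<noteq> 0" and "c dvd 1"
    and A: "A * symplectic_form n * A\<^sup>T = c \<cdot>\<^sub>m symplectic_form n"
    and eq: "sigma_matrix n q S * A = X * sigma_matrix n q S'"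
  shows "X \<in> GSp n"
proof -
  let ?J = "symplectic_form n :: 'a mat"
  let ?s = "sigma_matrix n q S" and ?s' = "sigma_matrix n q S'"
  note mats = carrier sigma_matrix_carrier[OF carrier(3)] sigma_matrix_carrier[OF carrier(4)]
    symplectic_form_carrier[of n, where 'a='a]
  note simps = assoc_mult_mat[of _ "2 * n" "2 * n" _ "2 * n" _ "2 * n"] mult_carrier_mat[of _ "2 * n" "2 * n" _ "2 * n"]
    transpose_mult[of _ "2 * n" "2 * n" _ "2 * n"] mult_smult_distrib[of _ "2 * n" "2 * n" _ "2 * n"]
    mult_smult_assoc_mat[of _ "2 * n" "2 * n" _ "2 * n"]
  have "q \<cdot>\<^sub>m (X * ?J * X\<^sup>T) = X * (?s' * ?J * ?s'\<^sup>T) * X\<^sup>T"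
    unfolding sigma_matrix_symplectic[OF carrier(4) sym(2)] using mats by (simp add: simps)
  also have "\<dots> = (X * ?s') * ?J * (X * ?s')\<^sup>T"
    using mats by (simp add: simps)
  also have "\<dots> = ?s * (A * ?J * A\<^sup>T) * ?s\<^sup>T"
    unfolding eq[symmetric] using mats by (simp add: simps)
  also have "\<dots> = c \<cdot>\<^sub>m (?s * ?J * ?s\<^sup>T)"
    unfolding A using mats by (simp add: simps)
  also have "\<dots> = q \<cdot>\<^sub>m (c \<cdot>\<^sub>m ?J)"
    unfolding sigma_matrix_symplectic[OF carrier(3) sym(1)] by (simp add: smult_smult_mat mult.commute)
  finally have eq': "q \<cdot>\<^sub>m (X * ?J * X\<^sup>T) = q \<cdot>\<^sub>m (c \<cdot>\<^sub>m ?J)" .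
  have dims: "X * ?J * X\<^sup>T \<in> carrier_mat (2 * n) (2 * n)" "c \<cdot>\<^sub>m ?J \<in> carrier_mat (2 * n) (2 * n)"
    using mats by (simp_all add: simps)
  have "X * ?J * X\<^sup>T = c \<cdot>\<^sub>m ?J"
    by (rule smult_cancel_mat[OF dims \<open>q \<noteq> 0\<close> eq'])
  then show ?thesis
    unfolding GSp_def using carrier(2) \<open>c dvd 1\<close> by blast
qed

interpretation padic_of_int: inj_idom_hom "padic_of_int :: 'p::prime_card padic_int \<Rightarrow> 'p padic"
proof
  fix x y :: "'p padic_int"
  show "padic_of_int (x + y) = padic_of_int x + padic_of_int y"
    "padic_of_int (x * y) = padic_of_int x * padic_of_int y"
    by (simp_all add: padic_of_int_def)
  show "padic_of_int 0 = (0 :: 'p padic)" "padic_of_int 1 = (1 :: 'p padic)"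
    by (simp_all add: padic_of_int_def Zero_fract_def One_fract_def)
  show "x = 0" if "padic_of_int x = (0 :: 'p padic)"
    using that by (simp add: padic_of_int_def Zero_fract_def eq_fract)
qed

lemma map_mat_sigma:
  assumes "S \<in> carrier_mat n n"
  shows "map_mat (of_int :: int \<Rightarrow> 'a::comm_ring_1) (sigma p n S) = sigma_matrix n (of_nat p) (map_mat of_int S)"
  unfolding sigma_def sigma_matrix_def using assms by (intro eq_matI) auto

lemma det_sigma_matrix:
  fixes q :: "'a::idom"
  assumes "S \<in> carrier_mat n n"
  shows "det (sigma_matrix n q S) = q ^ n"
  unfolding sigma_matrix_def using assms
  by (subst det_four_block_mat_lower_left_zero[of _ n _ n]) auto

lemma of_nat_card_padic_neq_0: "(of_nat CARD('p) :: 'p::prime_card padic_int) \<noteq> 0"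
proof -
  have Rep: "Rep_padic_int (of_nat m :: 'p padic_int) n = int m mod int CARD('p) ^ n" for m n
    by (induction m) (simp_all add: zero_padic_int.rep_eq one_padic_int.rep_eq plus_padic_int.rep_eq mod_simps)
  have "int CARD('p) < int CARD('p) ^ 2"
    using prime_gt_1_nat[OF prime_card[where 'a='p]] by (simp add: power2_eq_square)
  then have "Rep_padic_int (of_nat CARD('p) :: 'p padic_int) 2 \<noteq> 0"
    unfolding Rep using prime_gt_1_nat[OF prime_card[where 'a='p]] by simp
  then show ?thesis
    by (metis zero_padic_int.rep_eq)
qed

text \<open>
  Clearing the inverse of \<open>\<sigma>\<^sub>2\<close> removes the field of fractions.
\<close>

lemma D_equivalent_iff_integral_factor:
  fixes S\<^sub>1 S\<^sub>2 :: "int mat"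
  assumes n: "n = r + s" and S: "S\<^sub>1 \<in> carrier_mat n n" "S\<^sub>2 \<in> carrier_mat n n"
  shows "D_equivalent TYPE('p::prime_card) r s \<Delta> (sigma CARD('p) n S\<^sub>1) (sigma CARD('p) n S\<^sub>2) \<longleftrightarrow>
    (\<exists>\<gg> \<in> (GV r s \<Delta> :: ('p padic_int mat \<times> 'p padic_int mat) set). \<exists>X \<in> GSp n.
      sigma_matrix n (of_nat CARD('p)) (map_mat of_int S\<^sub>1) * alpha r s \<Delta> \<gg> =
      X * sigma_matrix n (of_nat CARD('p)) (map_mat of_int S\<^sub>2))"
proof -
  let ?h = "map_mat (padic_of_int :: 'p padic_int \<Rightarrow> 'p padic)"
  define s1 s2 where "s1 = sigma_matrix n (of_nat CARD('p) :: 'p padic_int) (map_mat of_int S\<^sub>1)"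
    and "s2 = sigma_matrix n (of_nat CARD('p) :: 'p padic_int) (map_mat of_int S\<^sub>2)"
  have s12: "s1 \<in> carrier_mat (2 * n) (2 * n)" "s2 \<in> carrier_mat (2 * n) (2 * n)"
    using S by (simp_all add: s1_def s2_def)
  have img: "map_mat (of_int :: int \<Rightarrow> 'p padic) (sigma CARD('p) n S\<^sub>1) = ?h s1"
    "map_mat (of_int :: int \<Rightarrow> 'p padic) (sigma CARD('p) n S\<^sub>2) = ?h s2"
    unfolding s1_def s2_def map_mat_sigma[OF S(1), symmetric] map_mat_sigma[OF S(2), symmetric]
    by (auto intro!: eq_matI simp: padic_of_int.hom_of_int)
  have "det (?h s2) \<noteq> 0"
    using S by (simp add: s2_def det_sigma_matrix of_nat_card_padic_neq_0)
  then have "?h s2 \<in> Units (ring_mat TYPE('p padic) (2 * n) ())"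
    using s12 by (intro det_non_zero_imp_unit) auto
  then have "mat_inverse (?h s2) \<noteq> None"
    using mat_inverse(1)[of "?h s2" "2 * n" "()"] s12 by auto
  then obtain T where T: "mat_inverse (?h s2) = Some T"
    by blast
  then have inv: "?h s2 * T = 1\<^sub>m (2 * n)" "T * ?h s2 = 1\<^sub>m (2 * n)" "T \<in> carrier_mat (2 * n) (2 * n)"
    using mat_inverse(2)[of "?h s2" "2 * n" T] s12 by auto
  have key: "?h s1 * ?h A * T \<in> ?h ` GSp n \<longleftrightarrow> (\<exists>X \<in> GSp n. s1 * A = X * s2)"
    if A: "A \<in> carrier_mat (2 * n) (2 * n)" for A
  proof -
    have "?h s1 * ?h A * T = ?h X \<longleftrightarrow> s1 * A = X * s2" if X: "X \<in> carrier_mat (2 * n) (2 * n)" for X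
    proof
      assume eq: "?h s1 * ?h A * T = ?h X"
      have "?h (s1 * A) = ?h s1 * ?h A * (T * ?h s2)"
        unfolding inv using s12 A by (simp add: padic_of_int.mat_hom_mult[of _ "2 * n" "2 * n" _ "2 * n"])
      also have "\<dots> = ?h s1 * ?h A * T * ?h s2"
        using s12 A inv(3) by (simp add: assoc_mult_mat[of _ "2 * n" "2 * n" _ "2 * n" _ "2 * n"])
      also have "\<dots> = ?h (X * s2)"
        unfolding eq using s12 X by (simp add: padic_of_int.mat_hom_mult[of _ "2 * n" "2 * n" _ "2 * n"])
      finally show "s1 * A = X * s2"
        by (rule padic_of_int.mat_hom_inj)
    next
      assume "s1 * A = X * s2"
      then have "?h (s1 * A) = ?h (X * s2)"
        by simp
      then have "?h s1 * ?h A = ?h X * ?h s2"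
        using s12 A X by (simp add: padic_of_int.mat_hom_mult[of _ "2 * n" "2 * n" _ "2 * n"])
      then have "?h s1 * ?h A * T = ?h X * (?h s2 * T)"
        using s12 X inv(3) by (simp add: assoc_mult_mat[of _ "2 * n" "2 * n" _ "2 * n" _ "2 * n"])
      then show "?h s1 * ?h A * T = ?h X"
        using inv X by simp
    qed
    moreover have "X \<in> carrier_mat (2 * n) (2 * n)" if "X \<in> GSp n" for X :: "'p padic_int mat"
      using that by (simp add: GSp_def)
    ultimately show ?thesis
      unfolding image_iff by blast
  qed
  have alpha_carrier: "alpha r s \<Delta> \<gg> \<in> carrier_mat (2 * n) (2 * n)" if "\<gg> \<in> GV r s \<Delta>" for \<gg> :: "'p padic_int mat \<times> 'p padic_int mat"
  proof -
    have "\<gg> \<in> carrier_mat n n \<times> carrier_mat n n"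
      using that unfolding GV_def n by blast
    then obtain h k where "\<gg> = (h, k)" "h \<in> carrier_mat n n" "k \<in> carrier_mat n n"
      by blast
    moreover have "sign_mat r s \<in> carrier_mat n n"
      by (simp add: sign_mat_def n)
    ultimately show ?thesis
      unfolding mult_2 by (auto simp: Let_def intro!: four_block_carrier_mat mult_carrier_mat)
  qed
  show ?thesis
    unfolding D_equivalent_def img T option.sel s1_def[symmetric] s2_def[symmetric] n[symmetric]
    by (intro bex_cong refl key alpha_carrier)
qed

section \<open>Nondegeneracy of the form for a span of full dimension\<close>

lemma span_full_dim:
  fixes A :: "'a::field vec set"
  assumes finite_A: "finite A" and A: "A \<subseteq> carrier_vec n"
    and dim: "subspace_dim n (LinearCombinations.module.span class_ring (module_vec TYPE('a) n) A) = n"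
  shows "LinearCombinations.module.span class_ring (module_vec TYPE('a) n) A = carrier_vec n"
proof -
  interpret vec_space "TYPE('a)" n .
  have sub: "submodule class_ring (span A) V"
    using A by (intro span_is_submodule) auto
  have vs: "vectorspace class_ring (vs (span A))"
    using A by (metis span_is_subspace subspace_is_vs module_vec_simps(3))
  have "vectorspace.fin_dim class_ring (vs (span A))"
    using finite_A A by (intro fin_dim_span) auto
  then obtain B where B: "finite B" "vectorspace.basis class_ring (vs (span A)) B"
    using vectorspace.finite_basis_exists[OF vs] by blast
  then have card: "card B = n"
    using vectorspace.dim_basis[OF vs B] dim by (simp add: subspace_dim_def)
  have Bsub: "B \<subseteq> span A" and li: "\<not> LinearCombinations.module.lin_dep class_ring (vs (span A)) B"
    and gen: "LinearCombinations.module.span class_ring (vs (span A)) B = span A"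
    using B(2) by (auto simp: vectorspace.basis_def[OF vs])
  have "lin_indpt B" "span B = span A"
    using li gen span_li_not_depend[OF Bsub sub] by auto
  moreover have "B \<subseteq> carrier V"
    using Bsub sub by (auto simp: submodule_def)
  ultimately have "basis B"
    using B(1) card by (intro dim_li_is_basis) (auto simp: dim_is_n)
  then show ?thesis
    using \<open>span B = span A\<close> by (simp add: basis_def)
qed

lemma span_orthogonal:
  fixes A :: "'a::field vec set"
  assumes "u \<in> carrier_vec n" and A: "A \<subseteq> carrier_vec n" and "\<And>v. v \<in> A \<Longrightarrow> v \<bullet> u = 0"
    and "v \<in> LinearCombinations.module.span class_ring (module_vec TYPE('a) n) A"
  shows "v \<bullet> u = 0"
proof -
  interpret vec_space "TYPE('a)" n .
  have "submodule class_ring {v \<in> carrier_vec n. v \<bullet> u = 0} V"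
    using assms(1) by unfold_locales (auto simp: module_vec_simps add_scalar_prod_distrib[of _ n])
  then have "span A \<subseteq> {v \<in> carrier_vec n. v \<bullet> u = 0}"
    using assms by (intro span_is_subset) auto
  then show ?thesis
    using assms(4) by auto
qed

lemma W_space_parametrization:
  assumes "S \<in> carrier_mat n n" and "S\<^sup>T = S"
    and "w \<in> (W_space n S :: 'p::prime_card mod_ring vec set)"
  obtains x where "x \<in> carrier_vec n" "w = x @\<^sub>v (map_mat of_int S *\<^sub>v x)"
proof -
  interpret vec_space "TYPE('p mod_ring)" "2 * n" .
  define S' where "S' = map_mat (of_int :: int \<Rightarrow> 'p mod_ring) S"
  have S': "S' \<in> carrier_mat n n" "S'\<^sup>T = S'"
    using assms(1,2) by (auto simp: S'_def map_mat_transpose)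
  define A where "A = four_block_mat (1\<^sub>m n) S' (0\<^sub>m 0 n) (0\<^sub>m 0 n)"
  have A: "A \<in> carrier_mat n (2 * n)"
    using S' four_block_carrier_mat[of "1\<^sub>m n" n n "0\<^sub>m 0 n" 0 n S' "0\<^sub>m 0 n"] by (simp add: A_def mult_2)
  have "w \<in> row_space A"
    using assms(3) by (simp add: W_space_def A_def S'_def)
  then obtain x where x: "x \<in> carrier_vec n" "A\<^sup>T *\<^sub>v x = w"
    using A by (auto simp: row_space_eq[OF A])
  have "A\<^sup>T *\<^sub>v x = x @\<^sub>v (S' *\<^sub>v x)"
  proof (rule eq_vecI)
    fix i assume "i < dim_vec (x @\<^sub>v (S' *\<^sub>v x))"
    then have i: "i < n + n"
      using x S' by auto
    show "(A\<^sup>T *\<^sub>v x) $ i = (x @\<^sub>v (S' *\<^sub>v x)) $ i"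
    proof (cases "i < n")
      case True
      then show ?thesis
        using i x(1) S' by (simp add: A_def scalar_prod_def mult_delta_left)
    next
      case False
      have sym: "S' $$ (a, b) = S' $$ (b, a)" if "a < n" "b < n" for a b
        using S' that by (metis carrier_matD index_transpose_mat(1))
      have "(A\<^sup>T *\<^sub>v x) $ i = (\<Sum>j = 0..<n. S' $$ (j, i - n) * x $ j)"
        using i x S' False by (auto simp: A_def scalar_prod_def intro!: sum.cong)
      also have "\<dots> = (S' *\<^sub>v x) $ (i - n)"
        using i x S' False by (auto simp: scalar_prod_def sym intro!: sum.cong)
      finally show ?thesis
        using False i x S' by simp
    qed
  qed (use A x S' in auto)
  then show thesis
    using that x by (simp add: S'_def)
qed

lemma sigma_inject:
  assumes "S \<in> carrier_mat n n" "S' \<in> carrier_mat n n" and eq: "sigma p n S = sigma p n S'"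
  shows "S = S'"
proof (rule eq_matI)
  fix i j assume "i < dim_row S'" "j < dim_col S'"
  then show "S $$ (i, j) = S' $$ (i, j)"
    using arg_cong[OF eq, of "\<lambda>M. M $$ (i, j + n)"] assms(1,2) by (simp add: sigma_def)
qed (use assms in auto)

text \<open>
  If \<open>T(S)y = 0\<close> with \<open>y \<noteq> 0\<close>, the nonzero vector \<open>(-Sy, y)\<close> is orthogonal to every \<open>(x, xS)\<close>, and also to its
  multiple by \<open>\<surd>d\<close>, where the scalar product is that of \<open>x\<close> and \<open>T(S)y\<close>. Then the span in question is
  a proper subspace.
\<close>

lemma D_set_full_imp:
  assumes S: "S \<in> carrier_mat n n" and n: "n = r + s"
    and D: "sigma CARD('p) n S \<in> D_set TYPE('p::prime_card) r s \<Delta> (2 * n)"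
  shows "S\<^sup>T = S" and "det (map_mat (of_int :: int \<Rightarrow> 'p mod_ring) (Tmat r s \<Delta> S)) \<noteq> 0"
proof -
  let ?S = "map_mat (of_int :: int \<Rightarrow> 'p mod_ring) S"
  let ?\<delta> = "of_int \<Delta> :: 'p mod_ring"
  interpret sign_form n "sign_mat r s :: 'p mod_ring mat" ?\<delta>
    unfolding n by (rule sign_form_sign_mat)
  from D obtain S' where S': "S' \<in> carrier_mat n n" "S'\<^sup>T = S'" "sigma CARD('p) n S = sigma CARD('p) n S'"
    "subspace_dim (2 * n) (qext_span r s \<Delta> (W_space n S' :: 'p mod_ring vec set)) = 2 * n"
    by (auto simp: D_set_def n)
  have "S' = S"
    using sigma_inject S S' by metis
  with S' show sym: "S\<^sup>T = S"
    by simp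
  have dim: "subspace_dim (2 * n) (qext_span r s \<Delta> (W_space n S :: 'p mod_ring vec set)) = 2 * n"
    using S' \<open>S' = S\<close> by simp
  have S_car: "?S \<in> carrier_mat n n" "?S\<^sup>T = ?S"
    using S sym by (auto simp: map_mat_transpose)
  define W where "W = {a \<cdot>\<^sub>v w + b \<cdot>\<^sub>v sqrt_act r s \<Delta> w | a b w. w \<in> (W_space n S :: 'p mod_ring vec set)}"
  show "det (map_mat (of_int :: int \<Rightarrow> 'p mod_ring) (Tmat r s \<Delta> S)) \<noteq> 0"
  proof
    assume "det (map_mat (of_int :: int \<Rightarrow> 'p mod_ring) (Tmat r s \<Delta> S)) = 0"
    then have "det (form ?S) = 0"
      unfolding map_mat_Tmat[OF S[unfolded n]] .
    then obtain y where y: "y \<in> carrier_vec n" "y \<noteq> 0\<^sub>v n" "form ?S *\<^sub>v y = 0\<^sub>v n"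
      using det_0_iff_vec_prod_zero[of "form ?S" n] S_car by auto
    define u where "u = (- (?S *\<^sub>v y)) @\<^sub>v y"
    have u: "u \<in> carrier_vec (2 * n)"
      using y S_car by (simp add: u_def mult_2)
    have orth: "w \<bullet> u = 0 \<and> sqrt_act r s \<Delta> w \<bullet> u = 0 \<and> w \<in> carrier_vec (2 * n) \<and> sqrt_act r s \<Delta> w \<in> carrier_vec (2 * n)"
      if w_mem: "w \<in> W_space n S" for w :: "'p mod_ring vec"
    proof -
      obtain x where x: "x \<in> carrier_vec n" and w: "w = x @\<^sub>v (?S *\<^sub>v x)"
        using W_space_parametrization[OF S sym w_mem] by blast
      have Sx: "?S *\<^sub>v x \<in> carrier_vec n" and Sy: "?S *\<^sub>v y \<in> carrier_vec n"
        using S_car x y by auto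
      have adj: "(M *\<^sub>v a) \<bullet> b = a \<bullet> (M *\<^sub>v b)"
        if "M \<in> carrier_mat n n" "M\<^sup>T = M" "a \<in> carrier_vec n" "b \<in> carrier_vec n" for M :: "'p mod_ring mat" and a b
        using transpose_vec_mult_scalar[of M n n b a] that by simp
      have "w \<bullet> u = x \<bullet> (- (?S *\<^sub>v y)) + (?S *\<^sub>v x) \<bullet> y"
        unfolding w u_def using x y Sx Sy by (intro scalar_prod_append) auto
      also have "\<dots> = 0"
        using x y Sy S_car by (simp add: adj)
      finally have 1: "w \<bullet> u = 0" .
      have first_last: "vec_first w n = x" "vec_last w n = ?S *\<^sub>v x"
      proof -
        have "vec_first (a @\<^sub>v b) n = a" "vec_last (a @\<^sub>v b) n = b"
          if "a \<in> carrier_vec n" "b \<in> carrier_vec n" for a b :: "'p mod_ring vec"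
          using that by (auto simp: vec_first_def vec_last_def intro!: eq_vecI)
        then show "vec_first w n = x" "vec_last w n = ?S *\<^sub>v x"
          unfolding w using x Sx by auto
      qed
      let ?E = "sign_mat r s :: 'p mod_ring mat"
      have act: "sqrt_act r s \<Delta> w = ((- ?\<delta>) \<cdot>\<^sub>v (?E *\<^sub>v (?S *\<^sub>v x))) @\<^sub>v (?E *\<^sub>v x)"
        unfolding sqrt_act_def Let_def n[symmetric] first_last E_sym by simp
      have Ex: "?E *\<^sub>v (?S *\<^sub>v x) \<in> carrier_vec n" "?E *\<^sub>v x \<in> carrier_vec n"
        using E_carrier x Sx by auto
      have "sqrt_act r s \<Delta> w \<bullet> u
          = ((- ?\<delta>) \<cdot>\<^sub>v (?E *\<^sub>v (?S *\<^sub>v x))) \<bullet> (- (?S *\<^sub>v y)) + (?E *\<^sub>v x) \<bullet> y"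
        unfolding act u_def using Ex y Sy by (intro scalar_prod_append) auto
      also have 3: "\<dots> = ?\<delta> * (x \<bullet> (?S *\<^sub>v (?E *\<^sub>v (?S *\<^sub>v y)))) + x \<bullet> (?E *\<^sub>v y)"
        using x y Sx Sy Ex S_car E_carrier E_sym by (simp add: adj)
      moreover have "(c \<cdot>\<^sub>m A) *\<^sub>v a = c \<cdot>\<^sub>v (A *\<^sub>v a)" if "A \<in> carrier_mat n n" "a \<in> carrier_vec n"
        for c and A :: "'p mod_ring mat" and a
        using that by (intro eq_vecI) (auto simp: scalar_prod_def sum_distrib_left mult.assoc)
      ultimately have "sqrt_act r s \<Delta> w \<bullet> u = x \<bullet> (form ?S *\<^sub>v y)"
        unfolding form_def using x y Sy S_car E_carrier
        by (simp add: add_mult_distrib_mat_vec[of _ n n] scalar_prod_add_distrib[of _ n] mult_carrier_mat[of _ n n _ n]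
            assoc_mult_mat_vec[of _ n n _ n] add.commute)
      also have "\<dots> = 0"
        using x y by simp
      finally have 2: "sqrt_act r s \<Delta> w \<bullet> u = 0" .
      show ?thesis
        using 1 2 x Sx Ex unfolding act by (simp add: w mult_2)
    qed
    have W_car: "W \<subseteq> carrier_vec (2 * n)"
      using orth by (auto simp: W_def)
    have W_orth: "v \<bullet> u = 0" if "v \<in> W" for v
      using that orth u by (auto simp: W_def add_scalar_prod_distrib[of _ "2 * n"])
    have "finite (carrier_vec (2 * n) :: 'p mod_ring vec set)"
    proof (rule finite_surj)
      show "finite {xs :: 'p mod_ring list. set xs \<subseteq> UNIV \<and> length xs = 2 * n}"
        by (rule finite_lists_length_eq) simp
      show "carrier_vec (2 * n) \<subseteq> vec_of_list ` {xs :: 'p mod_ring list. set xs \<subseteq> UNIV \<and> length xs = 2 * n}"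
      proof
        fix v :: "'p mod_ring vec" assume "v \<in> carrier_vec (2 * n)"
        then show "v \<in> vec_of_list ` {xs. set xs \<subseteq> UNIV \<and> length xs = 2 * n}"
          by (intro image_eqI[of _ _ "list_of_vec v"]) (auto simp: vec_list)
      qed
    qed
    then have "finite W"
      using W_car finite_subset by blast
    then have full: "LinearCombinations.module.span class_ring (module_vec TYPE('p mod_ring) (2 * n)) W = carrier_vec (2 * n)"
      using dim W_car by (intro span_full_dim) (auto simp: qext_span_def W_def n)
    have "u \<noteq> 0\<^sub>v (2 * n)"
    proof
      assume "u = 0\<^sub>v (2 * n)"
      then have "u $ (n + i) = 0" if "i < n" for i
        using that by simp
      then have "y = 0\<^sub>v n"
        using y(1) S_car(1) by (intro eq_vecI) (auto simp: u_def)
      then show False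
        using y(2) by simp
    qed
    then obtain i where i: "i < 2 * n" "u $ i \<noteq> 0"
      using u by (metis eq_vecI carrier_vecD index_zero_vec)
    have "unit_vec (2 * n) i \<bullet> u = 0"
      by (rule span_orthogonal[OF u W_car W_orth]) (simp_all add: full)
    then show False
      using i u by simp
  qed
qed

section \<open>D-equivalence as a congruence of symmetric matrices\<close>

lemma GV_iff_similitude:
  fixes h k :: "'p::prime_card padic_int mat"
  assumes n: "n = r + s"
  shows "(h, k) \<in> GV r s \<Delta> \<longleftrightarrow> h \<in> carrier_mat n n \<and> k \<in> carrier_mat n n \<and>
    (\<exists>c. c dvd 1 \<and> sign_form.similitude (sign_mat r s) (of_int \<Delta>) c h k)"
proof (cases "h \<in> carrier_mat n n \<and> k \<in> carrier_mat n n")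
  case True
  then have hk: "h \<in> carrier_mat n n" "k \<in> carrier_mat n n"
    by auto
  let ?E = "sign_mat r s :: 'p padic_int mat"
  interpret sign_form n ?E "of_int \<Delta> :: 'p padic_int"
    unfolding n by (rule sign_form_sign_mat)
  let ?d = "of_int (- \<Delta>) :: 'p padic_int"
  have car: "h * ?E * h\<^sup>T \<in> carrier_mat n n" "k * ?E * k\<^sup>T \<in> carrier_mat n n"
    "h * ?E * k\<^sup>T \<in> carrier_mat n n" "k * ?E * h\<^sup>T \<in> carrier_mat n n"
    "h * ?E \<in> carrier_mat n n" "k * ?E \<in> carrier_mat n n" "h\<^sup>T \<in> carrier_mat n n" "k\<^sup>T \<in> carrier_mat n n"
    using hk by (simp_all add: square_mat_simps)
  have "(- k)\<^sup>T = - k\<^sup>T"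
    by (rule transpose_uminus)
  moreover have "h * ?E + ?d \<cdot>\<^sub>m (k * 0\<^sub>m n n) = h * ?E" "h * 0\<^sub>m n n + k * ?E = k * ?E"
    using hk car by auto
  moreover have neg: "A * - B = - (A * B)" if "A \<in> carrier_mat n n" "B \<in> carrier_mat n n" for A B :: "'p padic_int mat"
    using that by (intro eq_matI) auto
  note neg[OF car(5,8)] neg[OF car(6,8)]
  ultimately have "qext_mult ?d (qext_mult ?d (h, k) (qext_sign_mat r s)) (qext_transpose (qext_conj (h, k)))
      = (h * ?E * h\<^sup>T + ?d \<cdot>\<^sub>m (- (k * ?E * k\<^sup>T)), - (h * ?E * k\<^sup>T) + k * ?E * h\<^sup>T)"
    using car by (simp add: qext_sign_mat_def n[symmetric] del: of_int_minus)
  moreover have "h * ?E * h\<^sup>T + ?d \<cdot>\<^sub>m (- (k * ?E * k\<^sup>T)) = h * ?E * h\<^sup>T + of_int \<Delta> \<cdot>\<^sub>m (k * ?E * k\<^sup>T)"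
    using car by (intro eq_matI) (auto simp del: index_mult_mat(1))
  moreover have "- (h * ?E * k\<^sup>T) + k * ?E * h\<^sup>T = 0\<^sub>m n n \<longleftrightarrow> k * ?E * h\<^sup>T = h * ?E * k\<^sup>T"
  proof -
    have "- A + B = 0\<^sub>m n n \<longleftrightarrow> B = A" if "A \<in> carrier_mat n n" "B \<in> carrier_mat n n" for A B :: "'p padic_int mat"
      using that by (auto simp: mat_eq_iff)
    then show ?thesis
      using car by blast
  qed
  moreover have "qext_smult c (qext_sign_mat r s) = (c \<cdot>\<^sub>m ?E, 0\<^sub>m n n)" for c
    unfolding qext_sign_mat_def n[symmetric] by (auto intro!: eq_matI)
  ultimately show ?thesis
    using hk by (simp add: GV_def similitude_def n[symmetric] del: qext_mult.simps qext_smult.simps)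
qed (auto simp: GV_def n)

lemma alpha_eq_alpha_matrix:
  "alpha r s \<Delta> (h, k) = sign_form.alpha_matrix (sign_mat r s) (of_int \<Delta>) h k"
  by (simp add: sign_form.alpha_matrix_def[OF sign_form_sign_mat] Let_def)

text \<open>
  The equation \<open>M(S\<^sub>1)\<gg> = NM(S\<^sub>2)\<close> is solved over \<open>\<int>\<^sub>p\<close> and not only modulo \<open>p\<close>, with the inverse \<open>U\<close> of \<open>T(S\<^sub>1)\<close>
  supplied by the unit determinant.
\<close>

lemma D_equivalent_if_congruent:
  fixes S\<^sub>1 S\<^sub>2 :: "int mat" and N :: "'p::prime_card padic_int mat"
  assumes n: "n = r + s"
    and S: "S\<^sub>1 \<in> carrier_mat n n" "S\<^sub>2 \<in> carrier_mat n n" "S\<^sub>1\<^sup>T = S\<^sub>1" "S\<^sub>2\<^sup>T = S\<^sub>2"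
    and unit: "det (map_mat of_int (Tmat r s \<Delta> S\<^sub>1) :: 'p padic_int mat) dvd 1" and "c dvd 1"
    and N: "N \<in> carrier_mat n n"
    and congr: "N * map_mat of_int (Tmat r s \<Delta> S\<^sub>2) * N\<^sup>T = c \<cdot>\<^sub>m map_mat of_int (Tmat r s \<Delta> S\<^sub>1)"
  shows "D_equivalent TYPE('p) r s \<Delta> (sigma CARD('p) n S\<^sub>1) (sigma CARD('p) n S\<^sub>2)"
proof -
  let ?E = "sign_mat r s :: 'p padic_int mat"
  interpret sign_form n ?E "of_int \<Delta> :: 'p padic_int"
    unfolding n by (rule sign_form_sign_mat)
  define s1 s2 where "s1 = (map_mat of_int S\<^sub>1 :: 'p padic_int mat)" and "s2 = (map_mat of_int S\<^sub>2 :: 'p padic_int mat)"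
  have s: "s1 \<in> carrier_mat n n" "s2 \<in> carrier_mat n n" "s1\<^sup>T = s1" "s2\<^sup>T = s2"
    using S by (auto simp: s1_def s2_def map_mat_transpose)
  have T: "map_mat of_int (Tmat r s \<Delta> S\<^sub>1) = form s1" "map_mat of_int (Tmat r s \<Delta> S\<^sub>2) = form s2"
    unfolding s1_def s2_def using S n by (simp_all add: map_mat_Tmat)
  obtain U where U: "U \<in> carrier_mat n n" "form s1 * U = 1\<^sub>m n" "U * form s1 = 1\<^sub>m n"
    using mat_inverse_of_unit_det[OF form_carrier[OF s(1)] unit[unfolded T(1)]] .
  define h k where "h = ?E * U * N + of_int \<Delta> \<cdot>\<^sub>m (s1 * U * N * s2 * ?E)"
    and "k = ?E * U * N * s2 * ?E + (- 1) \<cdot>\<^sub>m (s1 * U * N)"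
  have hk: "h \<in> carrier_mat n n" "k \<in> carrier_mat n n"
    unfolding h_def k_def using s U(1) N by (simp_all add: square_mat_simps)
  note lift = similitude_of_congruence[OF s(1,2) U(1) N s(3,4) U(2,3) congr[unfolded T] h_def k_def]
  obtain X where X: "X \<in> carrier_mat (2 * n) (2 * n)"
    "sigma_matrix n (of_nat CARD('p)) s1 * alpha_matrix h k = X * sigma_matrix n (of_nat CARD('p)) s2"
    using sigma_alpha_matrix_factors[OF hk s(1,2) N lift(2,3)] by blast
  have "X \<in> GSp n"
    using GSp_factor[OF alpha_matrix_carrier[OF hk] X(1) s of_nat_card_padic_neq_0 \<open>c dvd 1\<close>
        alpha_matrix_symplectic[OF hk lift(1)] X(2)] .
  moreover have "(h, k) \<in> GV r s \<Delta>"
    using GV_iff_similitude[OF n] hk \<open>c dvd 1\<close> lift(1) by blast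
  ultimately show ?thesis
    unfolding D_equivalent_iff_integral_factor[OF n S(1,2)] using X(2)
    by (metis alpha_eq_alpha_matrix s1_def s2_def)
qed

text \<open>
  The upper half of the integrality condition says that \<open>M(S\<^sub>1)\<gg> = N + PE\<surd>d\<close> with \<open>P = NS\<^sub>2\<close> modulo \<open>p\<close>, where \<open>N\<close> is the upper left block of \<open>X\<close>. Reducing the transported form modulo \<open>p\<close> then yields the congruence
  whose determinant is stated here.
\<close>

lemma D_equivalent_imp_det_relation:
  fixes S\<^sub>1 S\<^sub>2 :: "int mat"
  assumes n: "n = r + s"
    and S: "S\<^sub>1 \<in> carrier_mat n n" "S\<^sub>2 \<in> carrier_mat n n" "S\<^sub>1\<^sup>T = S\<^sub>1" "S\<^sub>2\<^sup>T = S\<^sub>2"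
    and equiv: "D_equivalent TYPE('p) r s \<Delta> (sigma CARD('p) n S\<^sub>1) (sigma CARD('p) n S\<^sub>2)"
  obtains x c :: "'p::prime_card mod_ring" where "c \<noteq> 0"
    and "x\<^sup>2 * det (map_mat of_int (Tmat r s \<Delta> S\<^sub>2)) = c ^ n * det (map_mat of_int (Tmat r s \<Delta> S\<^sub>1))"
proof -
  let ?E = "sign_mat r s :: 'p padic_int mat" and ?p = "of_nat CARD('p) :: 'p padic_int"
  interpret sign_form n ?E "of_int \<Delta> :: 'p padic_int"
    unfolding n by (rule sign_form_sign_mat)
  define s1 s2 where "s1 = (map_mat of_int S\<^sub>1 :: 'p padic_int mat)" and "s2 = (map_mat of_int S\<^sub>2 :: 'p padic_int mat)"
  have s: "s1 \<in> carrier_mat n n" "s2 \<in> carrier_mat n n" "s1\<^sup>T = s1" "s2\<^sup>T = s2"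
    using S by (auto simp: s1_def s2_def map_mat_transpose)
  obtain \<gg> X where "\<gg> \<in> GV r s \<Delta>" "X \<in> GSp n"
    "sigma_matrix n ?p s1 * alpha r s \<Delta> \<gg> = X * sigma_matrix n ?p s2"
    using equiv unfolding D_equivalent_iff_integral_factor[OF n S(1,2)] s1_def s2_def by blast
  moreover obtain h k where "\<gg> = (h, k)"
    by (cases \<gg>)
  ultimately obtain c where hk: "h \<in> carrier_mat n n" "k \<in> carrier_mat n n" and "c dvd 1" and sim: "similitude c h k"
    and X: "X \<in> carrier_mat (2 * n) (2 * n)"
    and eq: "sigma_matrix n ?p s1 * alpha_matrix h k = X * sigma_matrix n ?p s2"
    by (auto simp: GV_iff_similitude[OF n] alpha_eq_alpha_matrix GSp_def simp del: alpha.simps)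
  obtain X1 X2 X3 X4 where split: "split_block X n n = (X1, X2, X3, X4)"
    by (metis prod_cases4)
  have X_blocks: "X1 \<in> carrier_mat n n" "X2 \<in> carrier_mat n n" "X3 \<in> carrier_mat n n" "X4 \<in> carrier_mat n n"
    "X = four_block_mat X1 X2 X3 X4"
    using split_block[OF split, of n n] X by (auto simp: mult_2)
  let ?C = "(- of_int \<Delta>) \<cdot>\<^sub>m (?E * k)" and ?D = "?E * h * ?E"
  have CD: "?C \<in> carrier_mat n n" "?D \<in> carrier_mat n n" "k * ?E \<in> carrier_mat n n"
    using hk by (simp_all add: square_mat_simps)
  have blocks: "four_block_mat (h + s1 * ?C) (k * ?E + s1 * ?D) (?p \<cdot>\<^sub>m ?C) (?p \<cdot>\<^sub>m ?D)
      = four_block_mat X1 (X1 * s2 + ?p \<cdot>\<^sub>m X2) X3 (X3 * s2 + ?p \<cdot>\<^sub>m X4)"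
    using eq unfolding alpha_matrix_def X_blocks(5)
    by (simp only: sigma_matrix_mult_left[OF hk(1) CD(3,1,2) s(1)] sigma_matrix_mult_right[OF X_blocks(1-4) s(2)])
  have upper: "A = A'" "B = B'"
    if "four_block_mat A B C D = four_block_mat A' B' C' D'"
      "A \<in> carrier_mat n n" "B \<in> carrier_mat n n" "C \<in> carrier_mat n n" "D \<in> carrier_mat n n"
      "A' \<in> carrier_mat n n" "B' \<in> carrier_mat n n" "C' \<in> carrier_mat n n" "D' \<in> carrier_mat n n"
    for A B C D A' B' C' D' :: "'p padic_int mat"
  proof -
    have entry: "four_block_mat A B C D $$ (i, j) = four_block_mat A' B' C' D' $$ (i, j)" for i j
      using that(1) by simp
    show "A = A'"
    proof (rule eq_matI)
      show "A $$ (i, j) = A' $$ (i, j)" if "i < dim_row A'" "j < dim_col A'" for i j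
        using entry[of i j] that \<open>A \<in> _\<close> \<open>A' \<in> _\<close> \<open>D \<in> _\<close> \<open>D' \<in> _\<close> by simp
    qed (use that in auto)
    show "B = B'"
    proof (rule eq_matI)
      show "B $$ (i, j) = B' $$ (i, j)" if "i < dim_row B'" "j < dim_col B'" for i j
        using entry[of i "j + n"] that \<open>A \<in> _\<close> \<open>A' \<in> _\<close> \<open>B \<in> _\<close> \<open>B' \<in> _\<close> \<open>D \<in> _\<close> \<open>D' \<in> _\<close> by simp
    qed (use that in auto)
  qed
  define P where "P = k * ?E + s1 * ?E * h * ?E"
  have "h + s1 * ?C = X1" and "k * ?E + s1 * ?D = X1 * s2 + ?p \<cdot>\<^sub>m X2"
    using upper[OF blocks] hk CD X_blocks(1-4) s by (simp_all add: mult_carrier_mat[of _ n n _ n])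
  then have N: "X1 = h + (- of_int \<Delta>) \<cdot>\<^sub>m (s1 * ?E * k)" and P: "P = X1 * s2 + ?p \<cdot>\<^sub>m X2"
    unfolding P_def using hk s by (simp_all add: square_mat_simps)
  have transport: "X1 * ?E * X1\<^sup>T + of_int \<Delta> \<cdot>\<^sub>m (P * ?E * P\<^sup>T) = c \<cdot>\<^sub>m form s1"
    by (rule form_transport[OF hk s(1,3) sim N P_def])
  let ?r = "map_mat (padic_residue :: 'p padic_int \<Rightarrow> 'p mod_ring)"
  let ?F = "sign_mat r s :: 'p mod_ring mat"
  interpret res: sign_form n ?F "of_int \<Delta> :: 'p mod_ring"
    unfolding n by (rule sign_form_sign_mat)
  note hom_mult = padic_residue.mat_hom_mult[of _ n n _ n]
  have r_of_int: "?r (map_mat of_int A) = map_mat of_int A" for A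
    by (rule eq_matI) (auto simp: padic_residue.hom_of_int)
  have rE: "?r ?E = ?F"
    by (metis map_mat_sign_mat r_of_int)
  have r_form: "?r (map_mat of_int (Tmat r s \<Delta> S\<^sub>1)) = ?r (form s1)"
    unfolding s1_def using S n by (simp add: map_mat_Tmat)
  have T2: "map_mat of_int (Tmat r s \<Delta> S\<^sub>2) = res.form (?r s2)"
    unfolding s2_def r_of_int using S n by (simp add: map_mat_Tmat)
  have rP: "?r P = ?r X1 * ?r s2"
  proof -
    have "?r P = ?r (X1 * s2)"
      unfolding P using X_blocks(1-2) s(2) by (intro eq_matI)
        (auto simp: padic_residue.hom_add padic_residue.hom_mult padic_residue.hom_of_nat simp del: index_mult_mat(1))
    then show ?thesis
      using X_blocks(1) s(2) by (simp add: hom_mult)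
  qed
  have carrier: "?r X1 \<in> carrier_mat n n" "?r s2 \<in> carrier_mat n n" "P \<in> carrier_mat n n"
    "X1 * ?E * X1\<^sup>T \<in> carrier_mat n n" "P * ?E * P\<^sup>T \<in> carrier_mat n n"
    unfolding P using X_blocks s by (simp_all add: mult_carrier_mat[of _ n n _ n] E_carrier)
  have "?r X1 * res.form (?r s2) * (?r X1)\<^sup>T
      = ?r X1 * ?F * (?r X1)\<^sup>T + of_int \<Delta> \<cdot>\<^sub>m (?r P * ?F * (?r P)\<^sup>T)"
  proof -
    have "(?r s2)\<^sup>T = ?r s2"
      using s(4) by (simp add: map_mat_transpose)
    then show ?thesis
      unfolding res.form_def rP using carrier(1,2) by (simp add: res.square_mat_simps)
  qed
  also have "\<dots> = ?r (X1 * ?E * X1\<^sup>T + of_int \<Delta> \<cdot>\<^sub>m (P * ?E * P\<^sup>T))"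
  proof -
    have split: "?r (A + of_int \<Delta> \<cdot>\<^sub>m B) = ?r A + of_int \<Delta> \<cdot>\<^sub>m ?r B"
      if "A \<in> carrier_mat n n" "B \<in> carrier_mat n n" for A B
      using that by (intro eq_matI) (auto simp: padic_residue.hom_add padic_residue.hom_mult padic_residue.hom_of_int)
    have "?r (A * ?E * A\<^sup>T) = ?r A * ?F * (?r A)\<^sup>T" if "A \<in> carrier_mat n n" for A
      using that E_carrier by (simp add: hom_mult rE map_mat_transpose mult_carrier_mat[of _ n n _ n] del: assoc_mult_mat)
    then show ?thesis
      using split[OF carrier(4,5)] X_blocks(1) carrier(3) by simp
  qed
  also have "\<dots> = padic_residue c \<cdot>\<^sub>m ?r (form s1)"
    unfolding transport by (rule eq_matI) (auto simp: padic_residue.hom_mult)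
  finally have congr: "?r X1 * map_mat of_int (Tmat r s \<Delta> S\<^sub>2) * (?r X1)\<^sup>T
      = padic_residue c \<cdot>\<^sub>m map_mat of_int (Tmat r s \<Delta> S\<^sub>1)"
    unfolding T2 r_form[symmetric] r_of_int .
  have "(det (?r X1))\<^sup>2 * det (res.form (?r s2)) = padic_residue c ^ n * det (map_mat of_int (Tmat r s \<Delta> S\<^sub>1))"
  proof -
    have "dim_col (Tmat r s \<Delta> S\<^sub>1) = n"
      using S(1) by (simp add: Tmat_def)
    then show ?thesis
      using arg_cong[OF congr, of det] carrier(1,2) unfolding T2
      by (simp add: det_mult[of _ n] det_transpose[of _ n] mult_carrier_mat[of _ n n _ n] power2_eq_square mult_ac
          del: assoc_mult_mat)
  qed
  then show thesis
    using that[of "padic_residue c" "det (?r X1)"] \<open>c dvd 1\<close> unfolding T2 padic_int_unit_iff by blast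
qed

theorem theorem3p3p1:
  fixes \<Delta> :: int and r s g :: nat and R :: "int set" and S\<^sub>1 S\<^sub>2 :: "int mat"
  assumes "odd CARD('p::prime_card)"
    and "\<Delta> > 0" and "squarefree \<Delta>"
    and "inert_in_imag_quad_field CARD('p) \<Delta>"
    and "g = r + s"
    and "residue_system CARD('p) R"
    and "S\<^sub>1 \<in> carrier_mat g g" and "S\<^sub>2 \<in> carrier_mat g g"
    and "sigma CARD('p) g S\<^sub>1 \<in> D_set TYPE('p) r s \<Delta> (2 * g) \<inter> S_open CARD('p) g R"
    and "sigma CARD('p) g S\<^sub>2 \<in> D_set TYPE('p) r s \<Delta> (2 * g) \<inter> S_open CARD('p) g R"
  shows "D_equivalent TYPE('p) r s \<Delta> (sigma CARD('p) g S\<^sub>1) (sigma CARD('p) g S\<^sub>2) \<longleftrightarrow>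
    odd g \<or>
    even g \<and> (\<exists>y :: 'p mod_ring. y \<noteq> 0 \<and>
      det (map_mat of_int (Tmat r s \<Delta> S\<^sub>1)) / det (map_mat of_int (Tmat r s \<Delta> S\<^sub>2)) = y\<^sup>2)"
proof -
  note odd_p = assms(1) and g = assms(5)
  have sym: "S\<^sub>1\<^sup>T = S\<^sub>1" "S\<^sub>2\<^sup>T = S\<^sub>2"
    and nonsing: "det (map_mat (of_int :: int \<Rightarrow> 'p mod_ring) (Tmat r s \<Delta> S\<^sub>1)) \<noteq> 0"
      "det (map_mat (of_int :: int \<Rightarrow> 'p mod_ring) (Tmat r s \<Delta> S\<^sub>2)) \<noteq> 0"
    using D_set_full_imp[OF assms(7) g IntD1[OF assms(9)]] D_set_full_imp[OF assms(8) g IntD1[OF assms(10)]] by blast+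
  define T1 T2 where "T1 = (map_mat of_int (Tmat r s \<Delta> S\<^sub>1) :: 'p padic_int mat)"
    and "T2 = (map_mat of_int (Tmat r s \<Delta> S\<^sub>2) :: 'p padic_int mat)"
  define d1 d2 where "d1 = det (map_mat (of_int :: int \<Rightarrow> 'p mod_ring) (Tmat r s \<Delta> S\<^sub>1))"
    and "d2 = det (map_mat (of_int :: int \<Rightarrow> 'p mod_ring) (Tmat r s \<Delta> S\<^sub>2))"
  have d: "d1 \<noteq> 0" "d2 \<noteq> 0"
    using nonsing unfolding d1_def d2_def .
  have residue_det: "padic_residue (det T1) = d1" "padic_residue (det T2) = d2"
    by (simp_all add: T1_def T2_def d1_def d2_def padic_residue.hom_of_int)
  have units: "det T1 dvd 1" "det T2 dvd 1"
    using d residue_det by (simp_all add: padic_int_unit_iff)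
  interpret sign_form g "sign_mat r s :: 'p padic_int mat" "of_int \<Delta> :: 'p padic_int"
    unfolding g by (rule sign_form_sign_mat)
  interpret universal_local_ring "TYPE('p padic_int)"
    using odd_p by (rule universal_local_ring_padic_int)
  have T: "T1 \<in> carrier_mat g g" "T1\<^sup>T = T1" "T2 \<in> carrier_mat g g" "T2\<^sup>T = T2"
  proof -
    have "T1 = form (map_mat of_int S\<^sub>1)" "T2 = form (map_mat of_int S\<^sub>2)"
      unfolding T1_def T2_def using assms(7,8) g by (simp_all add: map_mat_Tmat)
    moreover have "map_mat of_int S\<^sub>1 \<in> carrier_mat g g" "map_mat of_int S\<^sub>2 \<in> carrier_mat g g"
      using assms(7,8) by simp_all
    moreover have "(map_mat of_int S\<^sub>1)\<^sup>T = (map_mat of_int S\<^sub>1 :: 'p padic_int mat)"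
      "(map_mat of_int S\<^sub>2)\<^sup>T = (map_mat of_int S\<^sub>2 :: 'p padic_int mat)"
      using sym by (simp_all add: map_mat_transpose)
    ultimately show "T1 \<in> carrier_mat g g" "T1\<^sup>T = T1" "T2 \<in> carrier_mat g g" "T2\<^sup>T = T2"
      using form_carrier form_sym by metis+
  qed
  have sufficient: "D_equivalent TYPE('p) r s \<Delta> (sigma CARD('p) g S\<^sub>1) (sigma CARD('p) g S\<^sub>2)"
    if "c dvd 1" "det T2 * (c ^ g * det T1) = w\<^sup>2" for c w
  proof -
    have "det (c \<cdot>\<^sub>m T1) = c ^ g * det T1"
      using T(1) by simp
    moreover have "c ^ g * det T1 dvd 1"
      using mult_dvd_mono[OF dvd_power_same[OF \<open>c dvd 1\<close>, of g] units(1)] by simp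
    ultimately have "congruent_mat g T2 (c \<cdot>\<^sub>m T1)"
      using T units that by (intro congruent_if_det_mult_square[of _ _ _ w]) (auto simp: transpose_smult_mat)
    then obtain N where "N \<in> carrier_mat g g" "N * T2 * N\<^sup>T = c \<cdot>\<^sub>m T1"
      unfolding congruent_mat_def by blast
    then show ?thesis
      using D_equivalent_if_congruent[OF g assms(7,8) sym] units(1) \<open>c dvd 1\<close> unfolding T1_def T2_def by blast
  qed
  show ?thesis
  proof (cases "even g")
    case False
    \<comment> \<open>The determinant of \<open>cT\<^sub>1\<close> is \<open>c\<^sup>g det T\<^sub>1\<close>, so with this \<open>c\<close> the product of the determinants is \<open>c\<^sup>g\<^sup>+\<^sup>1\<close>.\<close>
    let ?c = "det T1 * det T2"
    have "?c dvd 1"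
      using mult_dvd_mono[OF units] by simp
    moreover have "det T2 * (?c ^ g * det T1) = (?c ^ ((g + 1) div 2))\<^sup>2"
    proof -
      have "det T2 * (?c ^ g * det T1) = ?c ^ (g + 1)"
        by simp
      also have "g + 1 = (g + 1) div 2 * 2"
        using False by presburger
      finally show ?thesis
        by (simp only: power_mult)
    qed
    ultimately show ?thesis
      using sufficient False by blast
  next
    case True
    have "D_equivalent TYPE('p) r s \<Delta> (sigma CARD('p) g S\<^sub>1) (sigma CARD('p) g S\<^sub>2) \<longleftrightarrow>
      (\<exists>y. y \<noteq> 0 \<and> d1 / d2 = y\<^sup>2)"
    proof
      assume "D_equivalent TYPE('p) r s \<Delta> (sigma CARD('p) g S\<^sub>1) (sigma CARD('p) g S\<^sub>2)"
      then obtain c x :: "'p mod_ring" where c: "c \<noteq> 0" and eq: "x\<^sup>2 * d2 = c ^ g * d1"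
        using D_equivalent_imp_det_relation[OF g assms(7,8) sym] unfolding d1_def d2_def by metis
      have "g = g div 2 * 2"
        using True by simp
      then have "c ^ g = (c ^ (g div 2))\<^sup>2"
        by (metis power_mult)
      then have "d1 / d2 = (x / c ^ (g div 2))\<^sup>2"
        using eq c d by (simp add: power_divide field_simps)
      moreover have "d1 / d2 \<noteq> 0"
        using d by simp
      ultimately show "\<exists>y. y \<noteq> 0 \<and> d1 / d2 = y\<^sup>2"
        by (metis power_zero_numeral)
    next
      assume "\<exists>y. y \<noteq> 0 \<and> d1 / d2 = y\<^sup>2"
      then obtain y where y: "y \<noteq> 0" "d1 / d2 = y\<^sup>2"
        by blast
      have "padic_residue (det T2 * det T1) = (y * d2)\<^sup>2"
        using y d by (simp add: padic_residue.hom_mult residue_det power2_eq_square field_simps)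
      then obtain w where "w\<^sup>2 = det T2 * det T1"
        using padic_int_square_lift[OF odd_p] y d by (metis mult_eq_0_iff)
      then show "D_equivalent TYPE('p) r s \<Delta> (sigma CARD('p) g S\<^sub>1) (sigma CARD('p) g S\<^sub>2)"
        using sufficient[of 1 w] by simp
    qed
    then show ?thesis
      using True unfolding d1_def d2_def by simp
  qed
qed

end
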